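(* Let $S$ be a discrete abelian cancellative semigroup with unit $e$, let $\Gamma$ be the strong boundary of the uniform algebra $A(\widehat S)$, and let $F=\{|\psi|:\psi\in\Gamma\}$, so that $F\subseteq E(\widehat S)$ and $\Gamma=\coprod_{\rho\in F}\rho X$. Then the Shilov boundary of $A(\widehat S)$ satisfies $$\partial_{A(\widehat S)}=\coprod_{\rho\in K}\rho X$$ (disjoint union), where $K=[F]$, the closure of $F$ in $\widehat S$, is a compact subset of $E(\widehat S)$ containing $1$.
   Context: $S$ is a discrete abelian cancellative semigroup with unit $e$, written multiplicatively. A semicharacter of $S$ is a homomorphism $\psi$ from $S$ to the multiplicative semigroup $\overline{\mathbb D}=\{z\in\mathbb C:|z|\le 1\}$ that is not identically zero. $\widehat S$ is the set of all semicharacters with pointwise multiplication and the topology of pointwise convergence on $S$; it is a compact topological semigroup with unit $1$ (the constant function). $E(\widehat S)$ is the set of idempotents of $\widehat S$ (semicharacters with values in $\{0,1\}$), and $X\subseteq\widehat S$ the compact group of characters (semicharacters of modulus $1$ everywhere). For a nonnegative semicharacter $\rho$ and $\mathrm{Re}\,z>0$, $\rho^z(s)=\rho(s)^z$ (with $0^z=0$), and $\rho^0$ is the indicator function of $\{s:\rho(s)>0\}$. A function $F:\widehat S\setminus X\to\mathbb C$ is generalized analytic if for all $\rho,\psi\in\widehat S\setminus X$ with $\rho\ge 0$ the map $z\mapsto F(\rho^z\psi)$ is analytic in the open right half-plane $\Pi=\{\mathrm{Re}\,z>0\}$ and continuous at $+0$. $A(\widehat S)$ is the uniform algebra (sup norm)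 of all continuous functions on $\widehat S$ whose restriction to $\widehat S\setminus X$ is generalized analytic. The strong boundary of a uniform algebra $A$ on a compact space $Y$ is the set of its $p$-points, i.e. of the points $y\in Y$ such that $\{y\}$ is an intersection of peak sets of $A$. The Shilov boundary $\partial_{A(\widehat S)}$ is taken as a subset of $\widehat S$ (the smallest closed subset on which every function of the algebra attains its maximum modulus). *)

theory Defs
  imports "HOL-Analysis.Analysis" "HOL-Library.Function_Algebras" "HOL-Library.Disjoint_Sets"
begin

text \<open>
  The semigroup \<open>S\<close> is the whole type \<open>'s\<close>, with unit \<open>1\<close>.  The function type
  \<open>'s \<Rightarrow> complex\<close> carries the product topology (pointwise convergence) from the
  library and the pointwise product from \<^theory>\<open>HOL-Library.Function_Algebras\<close>; the
  unit \<open>1\<close> of the latter is the constant function.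
\<close>

definition semicharacters :: "('s::comm_monoid_mult \<Rightarrow> complex) set" where
  "semicharacters =
     {\<psi>. (\<forall>s t. \<psi> (s * t) = \<psi> s * \<psi> t) \<and> (\<forall>s. cmod (\<psi> s) \<le> 1) \<and> (\<exists>s. \<psi> s \<noteq> 0)}"

definition characters :: "('s::comm_monoid_mult \<Rightarrow> complex) set" where
  "characters = {\<psi> \<in> semicharacters. \<forall>s. cmod (\<psi> s) = 1}"

definition idempotents :: "('s::comm_monoid_mult \<Rightarrow> complex) set" where
  "idempotents = {\<psi> \<in> semicharacters. \<psi> * \<psi> = \<psi>}"

definition modulus :: "('s \<Rightarrow> complex) \<Rightarrow> 's \<Rightarrow> complex" where
  "modulus \<psi> = (\<lambda>s. complex_of_real (cmod (\<psi> s)))"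

text \<open>
  In the library \<open>0 powr z = 0\<close> for every \<open>z\<close>, including \<open>z = 0\<close>, and \<open>x powr 0 = 1\<close>
  for \<open>x \<noteq> 0\<close>; so at \<open>z = 0\<close> this is the indicator function of \<open>{s. \<rho> s > 0}\<close>.
\<close>

definition semichar_power :: "('s \<Rightarrow> complex) \<Rightarrow> complex \<Rightarrow> 's \<Rightarrow> complex" where
  "semichar_power \<rho> z = (\<lambda>s. \<rho> s powr z)"

text \<open>
  Functions on \<open>semicharacters\<close> or on \<open>semicharacters - characters\<close> are represented by total functions whose values
  elsewhere play no role.  Continuity at \<open>+0\<close> is \<open>F (\<rho>\<^sup>z \<psi>) \<longlongrightarrow> F (\<rho>\<^sup>0 \<psi>)\<close> as \<open>z \<rightarrow> 0\<close>
  in the open right half-plane.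
\<close>

definition generalized_analytic :: "(('s::comm_monoid_mult \<Rightarrow> complex) \<Rightarrow> complex) \<Rightarrow> bool" where
  "generalized_analytic F \<longleftrightarrow>
     (\<forall>\<rho> \<in> semicharacters - characters. \<forall>\<psi> \<in> semicharacters - characters.
        (\<forall>s. \<rho> s \<in> \<real>\<^sub>\<ge>\<^sub>0) \<longrightarrow>
          (\<lambda>z. F (semichar_power \<rho> z * \<psi>)) analytic_on {z. Re z > 0} \<and>
          continuous (at 0 within {z. Re z > 0}) (\<lambda>z. F (semichar_power \<rho> z * \<psi>)))"

definition semichar_algebra :: "(('s::comm_monoid_mult \<Rightarrow> complex) \<Rightarrow> complex) set" where
  "semichar_algebra = {F. continuous_on semicharacters F \<and> generalized_analytic F}"

definition peak_set :: "'b set \<Rightarrow> ('b \<Rightarrow> complex) set \<Rightarrow> 'b set \<Rightarrow> bool" where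
  "peak_set Y A P \<longleftrightarrow>
     P \<subseteq> Y \<and> (\<exists>f\<in>A. (\<forall>y\<in>P. f y = 1) \<and> (\<forall>y\<in>Y - P. cmod (f y) < 1))"

definition strong_boundary :: "'b set \<Rightarrow> ('b \<Rightarrow> complex) set \<Rightarrow> 'b set" where
  "strong_boundary Y A =
     {y \<in> Y. \<exists>\<P>. \<P> \<noteq> {} \<and> (\<forall>P\<in>\<P>. peak_set Y A P) \<and> \<Inter>\<P> = {y}}"

definition closed_boundary :: "'b::topological_space set \<Rightarrow> ('b \<Rightarrow> complex) set \<Rightarrow> 'b set \<Rightarrow> bool" where
  "closed_boundary Y A B \<longleftrightarrow>
     closedin (top_of_set Y) B \<and> (\<forall>f\<in>A. \<exists>b\<in>B. \<forall>y\<in>Y. cmod (f y) \<le> cmod (f b))"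

definition is_Shilov_boundary :: "'b::topological_space set \<Rightarrow> ('b \<Rightarrow> complex) set \<Rightarrow> 'b set \<Rightarrow> bool" where
  "is_Shilov_boundary Y A B \<longleftrightarrow>
     closed_boundary Y A B \<and> (\<forall>C. closed_boundary Y A C \<longrightarrow> B \<subseteq> C)"

definition translate :: "('s::comm_monoid_mult \<Rightarrow> complex) \<Rightarrow> ('s \<Rightarrow> complex) set" where
  "translate \<rho> = (\<lambda>\<xi>. \<rho> * \<xi>) ` characters"

end

theory Submission
  imports Defs "HOL-Complex_Analysis.Complex_Analysis"
begin

text \<open>
  The Shilov boundary of a uniform algebra is the closure of its strong boundary (Bishop), so the
  point is to describe the strong boundary \<open>\<Gamma>\<close>.  As \<open>S\<close> is cancellative and the circle is divisible,
  every semicharacter has a polar decomposition \<open>\<psi> = \<rho>\<xi>\<close> with \<open>\<rho> = |\<psi>|\<close> and a character \<open>\<xi>\<close>.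
  Multiplication by characters acts on the algebra, so \<open>\<Gamma>\<close> is a union of orbits \<open>\<rho>X\<close>.  If \<open>\<psi> \<in> \<Gamma>\<close>
  has \<open>\<rho> \<notin> X\<close>, a function \<open>f\<close> with \<open>|f| \<le> 1\<close> and \<open>f \<psi> = 1\<close> is, by the maximum principle, constant along
  \<open>z \<mapsto> \<rho>\<^sup>z \<rho>\<^sup>1\<^sup>/\<^sup>2 \<xi>\<close>, which passes through \<open>\<psi>\<close> at \<open>z = 1/2\<close>; as peak sets isolate \<open>\<psi>\<close>, the curve is
  constant and \<open>\<rho>\<close> is idempotent.  The functions \<open>(1 + \<psi> s)/2\<close> show that \<open>1 \<in> \<Gamma>\<close>.
\<close>

section \<open>The strong boundary of a uniform algebra\<close>

text \<open>The closed disc is strictly convex: \<open>Re w = 1\<close> together with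
  \<open>cmod w \<le> 1\<close> forces \<open>w = 1\<close>, and otherwise the cross term
  \<open>2 * Re w\<close> keeps the squared modulus of \<open>1 + w\<close> below 4.\<close>

lemma cmod_average_less_1:
  assumes "cmod w \<le> 1" "w \<noteq> 1"
  shows "cmod ((1 + w) / 2) < 1"
proof -
  have "Re w < 1"
  proof (rule ccontr)
    assume "\<not> Re w < 1"
    then have "Re w = 1"
      using complex_Re_le_cmod[of w] assms(1) by simp
    moreover have "(Re w)\<^sup>2 + (Im w)\<^sup>2 \<le> 1"
      using assms(1) by (simp add: cmod_def)
    ultimately show False
      using assms(2) by (simp add: complex_eq_iff)
  qed
  moreover have "(cmod w)\<^sup>2 \<le> 1"
    using assms(1) by (simp add: power_le_one)
  ultimately have "(cmod (1 + w))\<^sup>2 < 2\<^sup>2"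
    by (simp add: cmod_power2 power2_sum)
  then have "cmod (1 + w) < 2"
    by (rule power2_less_imp_less) simp
  then show ?thesis
    by (simp add: norm_divide)
qed

text \<open>The scalar estimate for the series of Bishop's argument, where \<open>t\<close> is the
  excess of \<open>cmod (g y)\<close> over 1 and \<open>b n\<close> is
  \<open>cmod (h n y * g y)\<close>. If \<open>t > 0\<close>, let \<open>m\<close> be the least
  index with \<open>(1/4) ^ (m + 1) \<le> t\<close>. The terms before \<open>m\<close> add up to at
  most \<open>(1 - (1/2) ^ m) * (1 + t)\<close>, the later ones to at most half of
  \<open>(1/2) ^ m\<close>.\<close>

lemma weighted_sum_le_1:
  fixes b :: "nat \<Rightarrow> real"
  assumes b0: "\<And>n. 0 \<le> b n"
    and le: "\<And>n. b n \<le> 1 \<or> b n \<le> 1 + t" and small: "\<And>n. (1/4) ^ (n + 1) \<le> t \<Longrightarrow> b n \<le> 1/2"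
  shows "summable (\<lambda>n. (1/2) ^ (n + 1) * b n)" "(\<Sum>n. (1/2) ^ (n + 1) * b n) \<le> 1"
proof -
  have geo: "(\<lambda>n. (1/2::real) ^ (n + 1)) sums 1"
    using power_half_series by simp
  have b_le: "b n \<le> max 1 (1 + t)" for n
    using le[of n] by auto
  show sm: "summable (\<lambda>n. (1/2) ^ (n + 1) * b n)"
  proof (rule summable_comparison_test')
    show "summable (\<lambda>n. (1/2) ^ (n + 1) * max 1 (1 + t))"
      using geo by (intro summable_mult2) (rule sums_summable)
    show "norm ((1/2) ^ (n + 1) * b n) \<le> (1/2) ^ (n + 1) * max 1 (1 + t)" for n
      using b_le[of n] b0[of n] by (simp add: abs_mult)
  qed
  show "(\<Sum>n. (1/2) ^ (n + 1) * b n) \<le> 1"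
  proof (cases "t \<le> 0")
    case True
    have "(\<Sum>n. (1/2) ^ (n + 1) * b n) \<le> (\<Sum>n. (1/2) ^ (n + 1))"
    proof (rule suminf_le[OF _ sm sums_summable[OF geo]])
      show "(1/2) ^ (n + 1) * b n \<le> (1/2) ^ (n + 1)" for n
        using b_le[of n] True by (intro mult_left_le) auto
    qed
    then show ?thesis using geo by (simp add: sums_iff)
  next
    case False
    then obtain k where "(1/4) ^ k < t"
      using real_arch_pow_inv[of t "1/4"] by auto
    moreover have "(1/4::real) ^ (k + 1) \<le> (1/4) ^ k"
      by (intro power_decreasing) auto
    ultimately have "\<exists>n. (1/4) ^ (n + 1) \<le> t"
      by (intro exI[of _ k]) linarith
    then obtain m where m: "(1/4) ^ (m + 1) \<le> t" "\<And>n. n < m \<Longrightarrow> t < (1/4) ^ (n + 1)"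
      using exists_least_iff[of "\<lambda>n. (1/4) ^ (n + 1) \<le> t"] by (auto simp: not_le)
    have small': "b n \<le> 1/2" if "m \<le> n" for n
    proof (rule small)
      have "(1/4::real) ^ (n + 1) \<le> (1/4) ^ (m + 1)"
        using that by (intro power_decreasing) auto
      then show "(1/4) ^ (n + 1) \<le> t" using m(1) by linarith
    qed
    have tail: "(\<lambda>n. (1/2::real) ^ (n + m + 1)) sums (1/2) ^ m"
      using sums_mult[OF geo, of "(1/2) ^ m"] by (simp add: power_add mult_ac)
    have head: "(\<Sum>n<m. (1/2::real) ^ (n + 1)) = 1 - (1/2) ^ m"
      by (induction m) auto
    have "(\<Sum>n. (1/2) ^ (n + m + 1) * b (n + m)) \<le> (\<Sum>n. (1/2) ^ (n + m + 1) * (1/2))"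
    proof (rule suminf_le)
      show "summable (\<lambda>n. (1/2) ^ (n + m + 1) * b (n + m))"
        using sm summable_iff_shift[of "\<lambda>n. (1/2) ^ (n + 1) * b n" m] by simp
      show "summable (\<lambda>n. (1/2::real) ^ (n + m + 1) * (1/2))"
        using tail by (intro summable_mult2) (rule sums_summable)
      show "(1/2) ^ (n + m + 1) * b (n + m) \<le> (1/2) ^ (n + m + 1) * (1/2)" for n
        using small'[of "n + m"] by (intro mult_left_mono) auto
    qed
    also have "\<dots> = (1/2) ^ m * (1/2)"
      using sums_mult2[OF tail, of "1/2"] by (simp only: sums_iff)
    finally have 1: "(\<Sum>n. (1/2) ^ (n + m + 1) * b (n + m)) \<le> (1/2) ^ m * (1/2)" .
    have "(\<Sum>n<m. (1/2) ^ (n + 1) * b n) \<le> (\<Sum>n<m. (1/2) ^ (n + 1) * (1 + t))"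
      using b_le False by (intro sum_mono mult_left_mono) auto
    also have "\<dots> = (1 - (1/2) ^ m) * (1 + t)"
      by (simp only: head flip: sum_distrib_right)
    finally have 2: "(\<Sum>n<m. (1/2) ^ (n + 1) * b n) \<le> (1 - (1/2) ^ m) * (1 + t)" .
    \<comment> \<open>For \<open>m = 0\<close> the first summand vanishes. Otherwise minimality of
      \<open>m\<close> at the index \<open>m - 1\<close> gives \<open>t < (1/4) ^ m\<close>, which
      is at most half of \<open>(1/2) ^ m\<close>.\<close>
    have "(1 - (1/2) ^ m) * (1 + t) + (1/2) ^ m * (1/2) \<le> 1"
    proof (cases m)
      case (Suc k)
      have "(1/2::real) ^ m \<le> 1/2"
        using Suc by (simp add: power_le_one)
      then have "(1/2::real) ^ m * (1/2) ^ m \<le> (1/2) ^ m * (1/2)"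
        by (intro mult_left_mono) auto
      moreover have "t \<le> (1/2) ^ m * (1/2) ^ m"
        using m(2)[of k] Suc by (simp flip: power_mult_distrib)
      moreover have "0 \<le> (1/2) ^ m * t"
        using False by simp
      moreover have "(1 - (1/2) ^ m) * (1 + t) + (1/2) ^ m * (1/2)
          = 1 + t - (1/2) ^ m * t - (1/2) ^ m * (1/2)"
        by (simp add: field_simps)
      ultimately show ?thesis
        by linarith
    qed auto
    moreover have "(\<Sum>n. (1/2) ^ (n + 1) * b n) =
        (\<Sum>n. (1/2) ^ (n + m + 1) * b (n + m)) + (\<Sum>n<m. (1/2) ^ (n + 1) * b n)"
      using suminf_split_initial_segment[OF sm, of m] by simp
    ultimately show ?thesis using 1 2 by linarith
  qed
qed

section \<open>Peak sets of a uniform algebra\<close>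

text \<open>Elements of \<open>A\<close> are total functions; closure under limits that are uniform
  on \<open>Y\<close> alone makes membership independent of the values off \<open>Y\<close>.
  Closedness of \<open>Y\<close> is listed next to compactness because the type \<open>'b\<close> is
  not assumed to be Hausdorff.\<close>

locale uniform_algebra =
  fixes Y :: "'b::topological_space set" and A :: "('b \<Rightarrow> complex) set"
  assumes compact_space: "compact Y"
    and closed_space: "closed Y"
    and nonempty_space: "Y \<noteq> {}"
    and continuous: "f \<in> A \<Longrightarrow> continuous_on Y f"
    and const: "(\<lambda>_. c) \<in> A"
    and add: "f \<in> A \<Longrightarrow> g \<in> A \<Longrightarrow> (\<lambda>y. f y + g y) \<in> A"
    and mult: "f \<in> A \<Longrightarrow> g \<in> A \<Longrightarrow> (\<lambda>y. f y * g y) \<in> A"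
    and uniform_closed: "(\<And>n. h n \<in> A) \<Longrightarrow> uniform_limit Y h g sequentially \<Longrightarrow> g \<in> A"
    and separates: "x \<in> Y \<Longrightarrow> y \<in> Y \<Longrightarrow> x \<noteq> y \<Longrightarrow> \<exists>f\<in>A. f x \<noteq> f y"
begin

lemma power: "f \<in> A \<Longrightarrow> (\<lambda>y. f y ^ n) \<in> A"
proof (induction n)
  case 0
  show ?case using const[of 1] by simp
next
  case (Suc n)
  show ?case using mult[OF Suc.prems Suc.IH[OF Suc.prems]] by simp
qed

lemma sum: "(\<And>i. i < n \<Longrightarrow> h i \<in> A) \<Longrightarrow> (\<lambda>y. \<Sum>i<n. h i y) \<in> A" for n :: nat
proof (induction n)
  case 0
  show ?case using const[of 0] by simp
next
  case (Suc n)
  have "(\<lambda>y. (\<Sum>i<n. h i y) + h n y) \<in> A"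
    by (rule add) (use Suc in auto)
  then show ?case by simp
qed

text \<open>The function \<open>(1 + f) / 2\<close> equals 1 where \<open>f\<close> does and has
  modulus below 1 elsewhere, even at points where \<open>f\<close> has modulus 1 but another
  value.\<close>

lemma peak_set_level_1:
  assumes "f \<in> A" and le: "\<And>y. y \<in> Y \<Longrightarrow> cmod (f y) \<le> 1"
  shows "peak_set Y A {y \<in> Y. f y = 1}"
  unfolding peak_set_def
proof (intro conjI bexI)
  show "(\<lambda>y. (1/2) * (1 + f y)) \<in> A"
    by (intro mult add const assms)
  show "\<forall>y\<in>Y - {y \<in> Y. f y = 1}. cmod ((1/2) * (1 + f y)) < 1"
    using cmod_average_less_1 le by auto
qed auto

lemma peak_set_space: "peak_set Y A Y"
  using peak_set_level_1[OF const[of 1]] by simp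

lemma peak_setE:
  assumes "peak_set Y A P"
  obtains f where "f \<in> A" "P = {y \<in> Y. f y = 1}" "\<And>y. y \<in> Y \<Longrightarrow> cmod (f y) \<le> 1"
    "\<And>y. y \<in> Y - P \<Longrightarrow> cmod (f y) < 1"
proof -
  from assms obtain f where f: "P \<subseteq> Y" "f \<in> A" "\<forall>y\<in>P. f y = 1" "\<forall>y\<in>Y - P. cmod (f y) < 1"
    unfolding peak_set_def by auto
  show ?thesis
  proof
    show "f \<in> A" by fact
    have "y \<in> P" if "y \<in> Y" "f y = 1" for y
      using f(4)[rule_format, of y] that by (cases "y \<in> P") auto
    then show "P = {y \<in> Y. f y = 1}"
      using f(1,3) by blast
    show "cmod (f y) \<le> 1" if "y \<in> Y" for y
      using f(3,4)[rule_format, of y] that by (cases "y \<in> P") auto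
    show "cmod (f y) < 1" if "y \<in> Y - P" for y
      using f(4) that by blast
  qed
qed

text \<open>The product of the two peaking functions peaks on the intersection.\<close>

lemma peak_set_Int:
  assumes "peak_set Y A P" "peak_set Y A Q"
  shows "peak_set Y A (P \<inter> Q)"
proof -
  obtain f where f: "f \<in> A" "P = {y \<in> Y. f y = 1}" "\<And>y. y \<in> Y \<Longrightarrow> cmod (f y) \<le> 1"
    "\<And>y. y \<in> Y - P \<Longrightarrow> cmod (f y) < 1" using peak_setE[OF assms(1)] by blast
  obtain g where g: "g \<in> A" "Q = {y \<in> Y. g y = 1}" "\<And>y. y \<in> Y \<Longrightarrow> cmod (g y) \<le> 1"
    "\<And>y. y \<in> Y - Q \<Longrightarrow> cmod (g y) < 1" using peak_setE[OF assms(2)] by blast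
  show ?thesis
    unfolding peak_set_def
  proof (intro conjI bexI ballI)
    show "(\<lambda>y. f y * g y) \<in> A"
      by (intro mult f g)
    fix y assume y: "y \<in> Y - P \<inter> Q"
    then consider "y \<in> Y - P" | "y \<in> Y - Q" by auto
    then show "cmod (f y * g y) < 1"
    proof cases
      case 1
      have "cmod (f y) * cmod (g y) \<le> cmod (f y)"
        using g(3)[of y] y by (simp add: mult_left_le)
      also have "\<dots> < 1" using f(4)[OF 1] .
      finally show ?thesis by (simp add: norm_mult)
    next
      case 2
      have "cmod (f y) * cmod (g y) \<le> cmod (g y)"
        using f(3)[of y] y by (simp add: mult_left_le_one_le)
      also have "\<dots> < 1" using g(4)[OF 2] .
      finally show ?thesis by (simp add: norm_mult)
    qed
  qed (use f(2) g(2) in auto)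
qed

text \<open>Intersecting with \<open>Y\<close> covers the empty family, whose intersection is the
  whole type.\<close>

lemma peak_set_Inter_finite:
  "finite \<Q> \<Longrightarrow> (\<And>P. P \<in> \<Q> \<Longrightarrow> peak_set Y A P) \<Longrightarrow> peak_set Y A (Y \<inter> \<Inter>\<Q>)"
proof (induction rule: finite_induct)
  case empty
  then show ?case using peak_set_space by simp
next
  case (insert P \<Q>)
  have "peak_set Y A (P \<inter> (Y \<inter> \<Inter>\<Q>))"
  proof (rule peak_set_Int)
    show "peak_set Y A P"
      by (rule insert.prems) simp
    show "peak_set Y A (Y \<inter> \<Inter>\<Q>)"
      by (rule insert.IH) (rule insert.prems, simp)
  qed
  moreover have "P \<inter> (Y \<inter> \<Inter>\<Q>) = Y \<inter> \<Inter>(insert P \<Q>)"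
    by blast
  ultimately show ?case
    by simp
qed

lemma closed_level_ge:
  assumes "f \<in> A"
  shows "closed {y \<in> Y. r \<le> cmod (f y)}"
proof -
  have "closed (Y \<inter> (\<lambda>y. cmod (f y)) -` {r..})"
    by (intro continuous_closed_preimage continuous_on_norm continuous assms closed_space closed_atLeast)
  also have "Y \<inter> (\<lambda>y. cmod (f y)) -` {r..} = {y \<in> Y. r \<le> cmod (f y)}"
    by auto
  finally show ?thesis .
qed

lemma closed_peak_set:
  assumes "peak_set Y A P"
  shows "closed P"
proof -
  obtain f where f: "f \<in> A" "P = {y \<in> Y. f y = 1}" "\<And>y. y \<in> Y \<Longrightarrow> cmod (f y) \<le> 1"
    "\<And>y. y \<in> Y - P \<Longrightarrow> cmod (f y) < 1" using peak_setE[OF assms(1)] by blast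
  have "P = {y \<in> Y. 1 \<le> cmod (f y)}"
    using f by force
  then show ?thesis
    using closed_level_ge[OF f(1)] by metis
qed

text \<open>By compactness finitely many members of \<open>\<P>\<close> already have an intersection
  that misses \<open>C\<close>. A function peaking on that intersection is bounded on
  \<open>C\<close> by some \<open>q < 1\<close>, and a high power of it is below
  \<open>\<epsilon>\<close> there.\<close>

lemma peaking_function_off_compact:
  assumes \<P>: "\<And>P. P \<in> \<P> \<Longrightarrow> peak_set Y A P"
    and C: "compact C" "C \<subseteq> Y" "C \<inter> \<Inter>\<P> = {}" and "0 < \<epsilon>"
  shows "\<exists>h\<in>A. (\<forall>y\<in>Y. cmod (h y) \<le> 1) \<and> (\<forall>y\<in>Y \<inter> \<Inter>\<P>. h y = 1) \<and> (\<forall>y\<in>C. cmod (h y) < \<epsilon>)"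
proof -
  obtain \<Q> where \<Q>: "finite \<Q>" "\<Q> \<subseteq> \<P>" "C \<inter> \<Inter>\<Q> = {}"
    using compact_imp_fip[OF C(1), of \<P>] closed_peak_set \<P> C(3) by blast
  have "peak_set Y A (Y \<inter> \<Inter>\<Q>)"
    using \<Q> \<P> by (intro peak_set_Inter_finite) auto
  then obtain k where k: "k \<in> A" "Y \<inter> \<Inter>\<Q> = {y \<in> Y. k y = 1}"
    "\<And>y. y \<in> Y \<Longrightarrow> cmod (k y) \<le> 1"
    "\<And>y. y \<in> Y - (Y \<inter> \<Inter>\<Q>) \<Longrightarrow> cmod (k y) < 1" by (rule peak_setE) blast
  have "\<exists>q<1. 0 \<le> q \<and> (\<forall>y\<in>C. cmod (k y) \<le> q)"
  proof (cases "C = {}")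
    case False
    obtain x where "x \<in> C" "\<forall>y\<in>C. cmod (k y) \<le> cmod (k x)"
      using continuous_attains_sup[OF C(1) False, of "\<lambda>y. cmod (k y)"]
        continuous_on_subset[OF continuous[OF k(1)] C(2)] by (auto intro: continuous_on_norm)
    moreover have "cmod (k x) < 1"
      using \<open>x \<in> C\<close> C \<Q> by (intro k(4)) auto
    ultimately show ?thesis by (intro exI[of _ "cmod (k x)"]) auto
  qed (auto intro: exI[of _ 0])
  then obtain q where q: "0 \<le> q" "q < 1" "\<And>y. y \<in> C \<Longrightarrow> cmod (k y) \<le> q" by auto
  obtain N where N: "q ^ N < \<epsilon>"
    using real_arch_pow_inv[OF \<open>0 < \<epsilon>\<close> q(2)] by blast
  show ?thesis
  proof (intro bexI[of _ "\<lambda>y. k y ^ N"] conjI ballI)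
    show "(\<lambda>y. k y ^ N) \<in> A" by (intro power k)
    show "cmod (k y ^ N) \<le> 1" if "y \<in> Y" for y
      using k(3)[OF that] by (simp add: norm_power power_le_one)
    show "k y ^ N = 1" if "y \<in> Y \<inter> \<Inter>\<P>" for y
    proof -
      have "y \<in> Y \<inter> \<Inter>\<Q>" using that \<Q> by auto
      then have "k y = 1" using k(2) by blast
      then show ?thesis by simp
    qed
    show "cmod (k y ^ N) < \<epsilon>" if "y \<in> C" for y
      using power_mono[OF q(3)[OF that], of N] N by (simp add: norm_power)
  qed
qed

text \<open>A pointwise criterion that replaces families of peak sets by single functions: each such
  \<open>f\<close> gives the peak set on which \<open>f\<close> equals 1, and these sets together
  exclude every point other than \<open>y\<close>.\<close>

lemma strong_boundary_iff:
  "y \<in> strong_boundary Y A \<longleftrightarrow>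
    y \<in> Y \<and> (\<forall>x\<in>Y. x \<noteq> y \<longrightarrow> (\<exists>f\<in>A. (\<forall>w\<in>Y. cmod (f w) \<le> 1) \<and> f y = 1 \<and> f x \<noteq> 1))"
proof (intro iffI conjI ballI impI)
  assume y: "y \<in> strong_boundary Y A"
  then show "y \<in> Y"
    by (simp add: strong_boundary_def)
  fix x assume x: "x \<in> Y" "x \<noteq> y"
  obtain \<P> where \<P>: "\<forall>P\<in>\<P>. peak_set Y A P" "\<Inter>\<P> = {y}"
    using y unfolding strong_boundary_def by blast
  then obtain P where P: "P \<in> \<P>" "x \<notin> P" "y \<in> P"
    using x(2) by blast
  obtain f where f: "f \<in> A" "P = {w \<in> Y. f w = 1}" "\<And>w. w \<in> Y \<Longrightarrow> cmod (f w) \<le> 1"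
    using peak_setE[of P] \<P>(1) P(1) by blast
  then show "\<exists>f\<in>A. (\<forall>w\<in>Y. cmod (f w) \<le> 1) \<and> f y = 1 \<and> f x \<noteq> 1"
    using P x(1) by (intro bexI[of _ f]) auto
next
  assume R: "y \<in> Y \<and> (\<forall>x\<in>Y. x \<noteq> y \<longrightarrow> (\<exists>f\<in>A. (\<forall>w\<in>Y. cmod (f w) \<le> 1) \<and> f y = 1 \<and> f x \<noteq> 1))"
  define \<P> where "\<P> = {P. peak_set Y A P \<and> y \<in> P}"
  have "Y \<in> \<P>"
    using R peak_set_space by (simp add: \<P>_def)
  moreover have "x = y" if x: "x \<in> \<Inter>\<P>" for x
  proof (rule ccontr)
    assume "x \<noteq> y"
    have "x \<in> Y"
      using x \<open>Y \<in> \<P>\<close> by blast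
    then obtain f where f: "f \<in> A" "\<forall>w\<in>Y. cmod (f w) \<le> 1" "f y = 1" "f x \<noteq> 1"
      using R \<open>x \<noteq> y\<close> by blast
    have "peak_set Y A {w \<in> Y. f w = 1}"
      by (rule peak_set_level_1) (use f in auto)
    then have "{w \<in> Y. f w = 1} \<in> \<P>"
      using R f by (simp add: \<P>_def)
    then have "x \<in> {w \<in> Y. f w = 1}"
      using x by (rule InterD[rotated])
    then show False
      using f(4) by simp
  qed
  moreover have "y \<in> \<Inter>\<P>"
    by (simp add: \<P>_def)
  ultimately have "\<P> \<noteq> {}" "\<Inter>\<P> = {y}"
    by blast+
  then show "y \<in> strong_boundary Y A"
    unfolding strong_boundary_def mem_Collect_eq
    using R by (intro conjI exI[of _ \<P>]) (auto simp: \<P>_def)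
qed

text \<open>
  Bishop's argument: in the series \<open>f = (\<Sum>n. (1/2)^(n+1) * h n * g)\<close> the function \<open>h n\<close> equals \<open>1\<close>
  on \<open>\<Inter>\<P>\<close> and is so small where \<open>cmod g \<ge> 1 + (1/4)^(n+1)\<close> that \<open>f\<close> is bounded by \<open>1\<close> on
  all of \<open>Y\<close>, although \<open>g\<close> is so bounded only on \<open>\<Inter>\<P>\<close>.
\<close>

lemma peak_set_relative:
  assumes \<P>: "\<And>P. P \<in> \<P> \<Longrightarrow> peak_set Y A P"
    and g: "g \<in> A" "\<And>y. y \<in> Y \<inter> \<Inter>\<P> \<Longrightarrow> cmod (g y) \<le> 1"
  obtains f where "f \<in> A" "\<And>y. y \<in> Y \<Longrightarrow> cmod (f y) \<le> 1"
    "\<And>y. y \<in> Y \<inter> \<Inter>\<P> \<Longrightarrow> f y = g y"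
proof -
  obtain B where B: "\<And>y. y \<in> Y \<Longrightarrow> cmod (g y) \<le> B" "0 < B"
  proof -
    have "bounded (g ` Y)"
      by (intro compact_imp_bounded compact_continuous_image continuous g compact_space)
    then show ?thesis
      using that by (auto simp: bounded_pos)
  qed
  define C where "C n = {y \<in> Y. 1 + (1/4) ^ (n + 1) \<le> cmod (g y)}" for n :: nat
  \<comment> \<open>Since \<open>B\<close> bounds \<open>g\<close> on \<open>Y\<close>, the bound
    \<open>1 / (2 * B)\<close> makes the product with \<open>g\<close> at most 1/2 on
    \<open>C n\<close>, as \<open>weighted_sum_le_1\<close> requires.\<close>
  have "\<exists>h\<in>A. (\<forall>y\<in>Y. cmod (h y) \<le> 1) \<and> (\<forall>y\<in>Y \<inter> \<Inter>\<P>. h y = 1)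
      \<and> (\<forall>y\<in>C n. cmod (h y) < 1 / (2 * B))" for n
  proof -
    have "compact (Y \<inter> C n)"
      unfolding C_def by (intro compact_Int_closed compact_space closed_level_ge g)
    moreover have "Y \<inter> C n = C n"
      by (auto simp: C_def)
    moreover have "C n \<inter> \<Inter>\<P> = {}"
    proof -
      have False if "y \<in> C n" "y \<in> \<Inter>\<P>" for y
      proof -
        have "cmod (g y) \<le> 1" "1 + (1/4) ^ (n + 1) \<le> cmod (g y)"
          using g(2)[of y] that by (auto simp: C_def)
        moreover have "0 < (1/4::real) ^ (n + 1)"
          by simp
        ultimately show False by linarith
      qed
      then show ?thesis by blast
    qed
    ultimately show ?thesis
      using \<P> B(2) by (intro peaking_function_off_compact) (auto simp: C_def)
  qed
  then obtain h where h: "\<And>n. h n \<in> A" "\<And>n y. y \<in> Y \<Longrightarrow> cmod (h n y) \<le> 1"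
    "\<And>n y. y \<in> Y \<inter> \<Inter>\<P> \<Longrightarrow> h n y = 1" "\<And>n y. y \<in> C n \<Longrightarrow> cmod (h n y) < 1 / (2 * B)"
    by metis
  define u where "u n y = (1/2) ^ (n + 1) * (h n y * g y)" for n y
  have norm_u: "norm (u n y) = (1/2) ^ (n + 1) * cmod (h n y * g y)" for n y
    unfolding u_def norm_mult[of "(1/2) ^ (n + 1)"] norm_power by (simp add: norm_divide)
  have hg_le: "cmod (h n y * g y) \<le> cmod (g y)" if "y \<in> Y" for n y
    using h(2)[OF that, of n] by (simp add: norm_mult mult_left_le_one_le)
  have sum_u: "summable (\<lambda>n. norm (u n y)) \<and> (\<Sum>n. norm (u n y)) \<le> 1" if "y \<in> Y" for y
  proof -
    have le: "cmod (h n y * g y) \<le> 1 \<or> cmod (h n y * g y) \<le> 1 + (cmod (g y) - 1)" for n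
      using hg_le[OF that] by simp
    have small: "cmod (h n y * g y) \<le> 1/2" if "(1/4) ^ (n + 1) \<le> cmod (g y) - 1" for n
    proof -
      have "y \<in> C n"
        using that \<open>y \<in> Y\<close> by (simp add: C_def)
      then have "cmod (h n y) * cmod (g y) \<le> 1 / (2 * B) * B"
        using h(4)[of y n] B(1)[OF \<open>y \<in> Y\<close>] B(2) by (intro mult_mono) auto
      then show ?thesis
        using B(2) by (simp add: norm_mult)
    qed
    show ?thesis
      unfolding norm_u using weighted_sum_le_1[of "\<lambda>n. cmod (h n y * g y)" "cmod (g y) - 1"] le small by auto
  qed
  define f where "f y = (\<Sum>n. u n y)" for y
  have "f \<in> A"
  proof (rule uniform_closed)
    show "(\<lambda>y. \<Sum>n<m. u n y) \<in> A" for m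
      unfolding u_def by (intro sum mult const h g)
    have "summable (\<lambda>n. (1/2) ^ (n + 1) * B)"
      using sums_summable[OF power_half_series] by (intro summable_mult2) simp
    moreover have "norm (u n y) \<le> (1/2) ^ (n + 1) * B" if "y \<in> Y" for n y
      unfolding norm_u using hg_le[OF that, of n] B(1)[OF that]
      by (intro mult_left_mono) auto
    ultimately show "uniform_limit Y (\<lambda>m y. \<Sum>n<m. u n y) f sequentially"
      unfolding f_def by (intro Weierstrass_m_test)
  qed
  moreover have "cmod (f y) \<le> 1" if "y \<in> Y" for y
    unfolding f_def using sum_u[OF that] summable_norm[of "\<lambda>n. u n y"] by linarith
  moreover have "f y = g y" if "y \<in> Y \<inter> \<Inter>\<P>" for y
  proof -
    \<comment> \<open>The weights add up to 1 and every \<open>h n y\<close> is 1 here, so the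
      series reproduces \<open>g y\<close>.\<close>
    have "(\<lambda>n. (1/2::complex) ^ (n + 1)) sums 1"
      using geometric_sums[of "1/2::complex"] sums_mult[of _ _ "1/2::complex"]
      by (fastforce simp: norm_divide)
    then have "(\<lambda>n. (1/2) ^ (n + 1) * g y) sums (1 * g y)"
      by (rule sums_mult2)
    then show ?thesis
      unfolding f_def u_def using h(3)[OF that] by (simp add: sums_iff)
  qed
  ultimately show ?thesis ..
qed

section \<open>Existence of p-points and the Shilov boundary\<close>

text \<open>Zorn's lemma gives a maximal family of peak sets that contains \<open>P\<close> and has
  the finite intersection property. By compactness its intersection is nonempty. Two points in the
  intersection could be told apart by a further peak set that still meets it, against
  maximality.\<close>

lemma strong_boundary_point_in_peak_set:
  assumes "peak_set Y A P" "P \<noteq> {}"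
  shows "P \<inter> strong_boundary Y A \<noteq> {}"
proof -
  define \<F> where "\<F> = {\<P>. P \<in> \<P> \<and> (\<forall>Q\<in>\<P>. peak_set Y A Q)
    \<and> (\<forall>\<Q>. finite \<Q> \<longrightarrow> \<Q> \<subseteq> \<P> \<longrightarrow> Y \<inter> \<Inter>\<Q> \<noteq> {})}"
  have PY: "P \<subseteq> Y"
    using assms by (simp add: peak_set_def)
  have "{P} \<in> \<F>"
    using assms PY nonempty_space unfolding \<F>_def by (auto simp: subset_singleton_iff)
  moreover have "\<Union>\<C> \<in> \<F>" if chain: "\<C> \<noteq> {}" "subset.chain \<F> \<C>" for \<C>
  proof -
    have sub: "\<C> \<subseteq> \<F>"
      using chain(2) by (simp add: subset.chain_def)
    have "Y \<inter> \<Inter>\<Q> \<noteq> {}" if fin: "finite \<Q>" "\<Q> \<subseteq> \<Union>\<C>" for \<Q>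
    proof -
      obtain \<P> where "\<P> \<in> \<C>" "\<Q> \<subseteq> \<P>"
        using finite_subset_Union_chain[OF fin chain] by blast
      then show ?thesis
        using sub fin(1) unfolding \<F>_def by blast
    qed
    then show ?thesis
      using sub chain(1) unfolding \<F>_def by blast
  qed
  ultimately obtain \<P> where \<P>: "\<P> \<in> \<F>" and max: "\<And>\<Q>. \<Q> \<in> \<F> \<Longrightarrow> \<P> \<subseteq> \<Q> \<Longrightarrow> \<Q> = \<P>"
    using subset_Zorn_nonempty[of \<F>] by (metis empty_iff)
  have "P \<in> \<P>" and peaks: "\<And>Q. Q \<in> \<P> \<Longrightarrow> peak_set Y A Q"
    and fip: "\<And>\<Q>. finite \<Q> \<Longrightarrow> \<Q> \<subseteq> \<P> \<Longrightarrow> Y \<inter> \<Inter>\<Q> \<noteq> {}"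
    using \<P> unfolding \<F>_def by auto
  have "Y \<inter> \<Inter>\<P> \<noteq> {}"
    using compact_imp_fip[OF compact_space, of \<P>] closed_peak_set peaks fip by blast
  then obtain x where x: "x \<in> Y" "x \<in> \<Inter>\<P>" by blast
  have "y = x" if "y \<in> \<Inter>\<P>" for y
  proof (rule ccontr)
    assume "y \<noteq> x"
    have "y \<in> Y"
      using that \<open>P \<in> \<P>\<close> PY by blast
    obtain k where k: "k \<in> A" "k x \<noteq> k y"
      using separates[of x y] x \<open>y \<in> Y\<close> \<open>y \<noteq> x\<close> by blast
    \<comment> \<open>The function \<open>l\<close> vanishes at \<open>y\<close> but not at
      \<open>x\<close>, so its maximum modulus over the intersection is positive and is attained at
      some \<open>z\<close> other than \<open>y\<close>. Normalizing at \<open>z\<close> gives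
      \<open>g\<close>, which is bounded by 1 on the intersection only;
      \<open>peak_set_relative\<close> extends the bound to \<open>Y\<close>.\<close>
    define l where "l z = k z - k y" for z
    have l: "l \<in> A"
      using add[OF k(1) const[of "- k y"]] unfolding l_def by simp
    have E: "compact (Y \<inter> \<Inter>\<P>)"
      using closed_peak_set peaks by (intro compact_Int_closed compact_space closed_Inter) auto
    have "continuous_on (Y \<inter> \<Inter>\<P>) (\<lambda>w. cmod (l w))"
      using continuous_on_subset[OF continuous[OF l], of "Y \<inter> \<Inter>\<P>"]
      by (intro continuous_on_norm) auto
    then obtain z where z: "z \<in> Y \<inter> \<Inter>\<P>" "\<And>w. w \<in> Y \<inter> \<Inter>\<P> \<Longrightarrow> cmod (l w) \<le> cmod (l z)"
      using continuous_attains_sup[OF E \<open>Y \<inter> \<Inter>\<P> \<noteq> {}\<close>] by metis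
    have "l z \<noteq> 0"
      using z(2)[of x] x k by (auto simp: l_def)
    define g where "g w = inverse (l z) * l w" for w
    have g: "g \<in> A"
      unfolding g_def by (intro mult const l)
    have "cmod (g w) \<le> 1" if "w \<in> Y \<inter> \<Inter>\<P>" for w
      using z(2)[OF that] \<open>l z \<noteq> 0\<close> by (simp add: g_def norm_divide divide_inverse_commute[symmetric])
    then obtain f where f: "f \<in> A" "\<And>w. w \<in> Y \<Longrightarrow> cmod (f w) \<le> 1"
      "\<And>w. w \<in> Y \<inter> \<Inter>\<P> \<Longrightarrow> f w = g w"
      using peak_set_relative[OF peaks g] by blast
    define Q where "Q = {w \<in> Y. f w = 1}"
    have "z \<in> Q" "y \<notin> Q"
      using z(1) f(3)[of z] f(3)[of y] \<open>l z \<noteq> 0\<close> \<open>y \<in> \<Inter>\<P>\<close> by (auto simp: Q_def g_def l_def)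
    have "peak_set Y A Q"
      unfolding Q_def using f by (intro peak_set_level_1)
    \<comment> \<open>The point \<open>z\<close> lies in \<open>Q\<close> and in all members of
      \<open>\<P>\<close>, so the finite intersection property survives.\<close>
    have "insert Q \<P> \<in> \<F>"
      unfolding \<F>_def using \<open>P \<in> \<P>\<close> \<open>peak_set Y A Q\<close> peaks z(1) \<open>z \<in> Q\<close> by blast
    then have "Q \<in> \<P>"
      using max[of "insert Q \<P>"] by blast
    then show False
      using \<open>y \<in> \<Inter>\<P>\<close> \<open>y \<notin> Q\<close> by blast
  qed
  then have "\<Inter>\<P> = {x}"
    using x by blast
  then have "x \<in> strong_boundary Y A"
    unfolding strong_boundary_def mem_Collect_eq
    using x(1) \<open>P \<in> \<P>\<close> peaks by (intro conjI exI[of _ \<P>]) auto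
  then show ?thesis
    using x(2) \<open>P \<in> \<P>\<close> by blast
qed

text \<open>Dividing \<open>f\<close> by its value at a point of maximum modulus gives a function
  bounded by 1 whose level set at 1 is a nonempty peak set; such a set contains a p-point.\<close>

lemma attains_max_on_strong_boundary:
  assumes f: "f \<in> A"
  shows "\<exists>b\<in>strong_boundary Y A. \<forall>y\<in>Y. cmod (f y) \<le> cmod (f b)"
proof -
  obtain x where x: "x \<in> Y" "\<And>y. y \<in> Y \<Longrightarrow> cmod (f y) \<le> cmod (f x)"
    using continuous_attains_sup[OF compact_space nonempty_space, of "\<lambda>y. cmod (f y)"]
      continuous[OF f] by (auto intro: continuous_on_norm)
  show ?thesis
  proof (cases "f x = 0")
    case True
    have "Y \<inter> strong_boundary Y A \<noteq> {}"
      using peak_set_space nonempty_space by (rule strong_boundary_point_in_peak_set)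
    moreover have "cmod (f y) \<le> cmod (f b)" if "y \<in> Y" for y b
      using x(2)[OF that] True by simp
    ultimately show ?thesis by blast
  next
    case False
    define g where "g y = inverse (f x) * f y" for y
    have "peak_set Y A {y \<in> Y. g y = 1}"
    proof (rule peak_set_level_1)
      show "g \<in> A"
        unfolding g_def by (intro mult const f)
      show "cmod (g y) \<le> 1" if "y \<in> Y" for y
        using x(2)[OF that] False by (simp add: g_def norm_divide divide_inverse_commute[symmetric])
    qed
    moreover have "{y \<in> Y. g y = 1} \<noteq> {}"
      using x(1) False by (auto simp: g_def)
    ultimately obtain b where "b \<in> strong_boundary Y A" "g b = 1"
      using strong_boundary_point_in_peak_set by blast
    then have "b \<in> strong_boundary Y A" "f b = f x"
      using False by (auto simp: g_def field_simps)
    then show ?thesis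
      using x(2) by (intro bexI[of _ b]) auto
  qed
qed

lemma Shilov_boundary_closure_strong_boundary:
  "is_Shilov_boundary Y A (top_of_set Y closure_of strong_boundary Y A)"
  unfolding is_Shilov_boundary_def
proof (intro conjI allI impI)
  have sub: "strong_boundary Y A \<subseteq> Y"
    by (auto simp: strong_boundary_def)
  then show "closed_boundary Y A (top_of_set Y closure_of strong_boundary Y A)"
    unfolding closed_boundary_def
    using attains_max_on_strong_boundary closure_of_subset[of "strong_boundary Y A" "top_of_set Y"]
    by (metis closedin_closure_of subsetD topspace_euclidean_subtopology)
  fix C assume C: "closed_boundary Y A C"
  have "C \<subseteq> Y" "closed C"
    using C closed_space unfolding closed_boundary_def
    by (auto simp: closedin_closed_eq dest: closedin_imp_subset)
  then have "compact C"
    using compact_Int_closed[OF compact_space, of C] by (simp add: Int_absorb1)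
  \<comment> \<open>A p-point outside \<open>C\<close> would admit a function equal to 1 there and
    of modulus below 1 on all of \<open>C\<close>, so \<open>C\<close> would not be a
    boundary.\<close>
  have "strong_boundary Y A \<subseteq> C"
  proof
    fix x assume "x \<in> strong_boundary Y A"
    then obtain \<P> where \<P>: "\<And>P. P \<in> \<P> \<Longrightarrow> peak_set Y A P" "\<Inter>\<P> = {x}" and "x \<in> Y"
      unfolding strong_boundary_def by blast
    show "x \<in> C"
    proof (rule ccontr)
      assume "x \<notin> C"
      then have "C \<inter> \<Inter>\<P> = {}"
        using \<P>(2) by simp
      then obtain h where h: "h \<in> A" "\<forall>y\<in>Y \<inter> \<Inter>\<P>. h y = 1" "\<forall>y\<in>C. cmod (h y) < 1"
        using peaking_function_off_compact[OF \<P>(1) \<open>compact C\<close> \<open>C \<subseteq> Y\<close> _ zero_less_one]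
        by blast
      obtain b where "b \<in> C" "cmod (h x) \<le> cmod (h b)"
        using C h(1) \<open>x \<in> Y\<close> unfolding closed_boundary_def by blast
      then show False
        using h(2)[rule_format, of x] h(3)[rule_format, of b] \<P>(2) \<open>x \<in> Y\<close> \<open>b \<in> C\<close> by simp
    qed
  qed
  then show "top_of_set Y closure_of strong_boundary Y A \<subseteq> C"
    using C unfolding closed_boundary_def by (intro closure_of_minimal) auto
qed

end

section \<open>Semicharacters\<close>

lemma semicharacter_mult:
  "\<psi> \<in> semicharacters \<Longrightarrow> \<psi> (s * t) = \<psi> s * \<psi> t"
  by (simp add: semicharacters_def)

lemma semicharacter_le_1: "\<psi> \<in> semicharacters \<Longrightarrow> cmod (\<psi> s) \<le> 1"
  by (simp add: semicharacters_def)

lemma semicharacter_1: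
  assumes "\<psi> \<in> semicharacters"
  shows "\<psi> 1 = 1"
proof -
  obtain s where "\<psi> s \<noteq> 0"
    using assms by (auto simp: semicharacters_def)
  then show ?thesis
    using semicharacter_mult[OF assms, of s 1] by simp
qed

lemma semicharactersI:
  assumes "\<And>s t. \<psi> (s * t) = \<psi> s * \<psi> t" "\<And>s. cmod (\<psi> s) \<le> 1" "\<psi> 1 = 1"
  shows "\<psi> \<in> semicharacters"
  using assms unfolding semicharacters_def by (auto intro!: exI[of _ 1])

lemma times_semicharacters:
  "\<phi> \<in> semicharacters \<Longrightarrow> \<psi> \<in> semicharacters \<Longrightarrow> \<phi> * \<psi> \<in> semicharacters"
  by (rule semicharactersI)
    (auto simp: semicharacter_mult semicharacter_1 norm_mult semicharacter_le_1 mult_le_one)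

lemma one_characters: "1 \<in> characters"
  by (auto simp: characters_def semicharacters_def)

lemma characters_subset: "characters \<subseteq> semicharacters"
  by (auto simp: characters_def)

lemma inverse_characters:
  assumes "\<xi> \<in> characters"
  shows "(\<lambda>s. inverse (\<xi> s)) \<in> characters"
  using assms unfolding characters_def
  by (auto intro!: semicharactersI simp: norm_inverse semicharacter_mult semicharacter_1)

lemma modulus_semicharacters:
  "\<psi> \<in> semicharacters \<Longrightarrow> modulus \<psi> \<in> semicharacters"
  by (rule semicharactersI)
    (auto simp: modulus_def norm_mult semicharacter_mult semicharacter_1 semicharacter_le_1)

lemma modulus_times_character:
  "\<xi> \<in> characters \<Longrightarrow> modulus (\<psi> * \<xi>) = modulus \<psi>"
  by (auto simp: modulus_def characters_def norm_mult fun_eq_iff)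

lemma idempotent_values:
  assumes "\<rho> \<in> idempotents"
  shows "\<rho> s = 0 \<or> \<rho> s = 1"
proof -
  have "(\<rho> * \<rho>) s = \<rho> s"
    using assms by (simp add: idempotents_def)
  then show ?thesis by simp
qed

lemma modulus_idempotent:
  assumes "\<rho> \<in> idempotents"
  shows "modulus \<rho> = \<rho>"
proof
  show "modulus \<rho> s = \<rho> s" for s
    using idempotent_values[OF assms, of s] by (auto simp: modulus_def)
qed

text \<open>The idempotent \<open>\<rho>\<close> is recovered from any element of
  \<open>translate \<rho>\<close> by taking the modulus.\<close>

lemma disjoint_translates:
  assumes "I \<subseteq> idempotents"
  shows "disjoint_family_on translate I"
  unfolding disjoint_family_on_def
proof (intro ballI impI)
  fix \<rho> \<sigma> assume "\<rho> \<in> I" "\<sigma> \<in> I" "\<rho> \<noteq> \<sigma>"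
  have "\<rho> = \<sigma>" if "\<rho> * \<xi> = \<sigma> * \<eta>" "\<xi> \<in> characters" "\<eta> \<in> characters" for \<xi> \<eta>
    using that modulus_times_character[of \<xi> \<rho>] modulus_times_character[of \<eta> \<sigma>]
      modulus_idempotent assms \<open>\<rho> \<in> I\<close> \<open>\<sigma> \<in> I\<close> by (metis subsetD)
  then show "translate \<rho> \<inter> translate \<sigma> = {}"
    using \<open>\<rho> \<noteq> \<sigma>\<close> unfolding translate_def by auto
qed

section \<open>Polar decomposition of semicharacters\<close>

text \<open>On the subsemigroup where \<psi> does not vanish, its sign is a homomorphism into the
  circle. As the circle is divisible, it extends to all of \<open>S\<close>: a maximal extension is
  first shown to be closed under division, then to be defined everywhere.\<close>

lemma sgn_semicharacter_extends:
  fixes \<psi> :: "'s::comm_monoid_mult \<Rightarrow> complex"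
  assumes cancel: "\<And>a b c :: 's. a * b = a * c \<Longrightarrow> b = c"
    and \<psi>: "\<psi> \<in> semicharacters"
  shows "\<exists>\<xi>\<in>characters. \<forall>s. \<psi> s \<noteq> 0 \<longrightarrow> \<xi> s = sgn (\<psi> s)"
proof -
  txt \<open>Partial homomorphisms into the circle, represented by their graphs.\<close>
  define \<R> where "\<R> = {R :: ('s \<times> complex) set. (\<forall>s z. (s, z) \<in> R \<longrightarrow> cmod z = 1)
    \<and> (\<forall>s z w. (s, z) \<in> R \<longrightarrow> (s, w) \<in> R \<longrightarrow> z = w)
    \<and> (\<forall>s z t w. (s, z) \<in> R \<longrightarrow> (t, w) \<in> R \<longrightarrow> (s * t, z * w) \<in> R)
    \<and> (\<forall>s. \<psi> s \<noteq> 0 \<longrightarrow> (s, sgn (\<psi> s)) \<in> R)}"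
  note hom = semicharacter_mult[OF \<psi>]
  have "{(s, sgn (\<psi> s)) | s. \<psi> s \<noteq> 0} \<in> \<R>"
    unfolding \<R>_def by (auto simp: hom sgn_mult norm_sgn)
  then have "\<R> \<noteq> {}"
    by blast
  moreover have "\<Union>\<C> \<in> \<R>" if "\<C> \<noteq> {}" "subset.chain \<R> \<C>" for \<C>
  proof -
    have sub: "\<C> \<subseteq> \<R>"
      using that(2) by (simp add: subset.chain_def)
    have two: "\<exists>R\<in>\<C>. p \<in> R \<and> q \<in> R" if "p \<in> \<Union>\<C>" "q \<in> \<Union>\<C>" for p q
      using that \<open>subset.chain \<R> \<C>\<close> unfolding subset_chain_def by blast
    show ?thesis
      unfolding \<R>_def mem_Collect_eq
    proof (intro conjI allI impI)
      fix s z assume "(s, z) \<in> \<Union>\<C>"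
      then show "cmod z = 1" using sub unfolding \<R>_def by blast
    next
      fix s z w assume "(s, z) \<in> \<Union>\<C>" "(s, w) \<in> \<Union>\<C>"
      then obtain R where "R \<in> \<C>" "(s, z) \<in> R" "(s, w) \<in> R" using two by blast
      then show "z = w" using sub unfolding \<R>_def by blast
    next
      fix s z t w assume "(s, z) \<in> \<Union>\<C>" "(t, w) \<in> \<Union>\<C>"
      then obtain R where "R \<in> \<C>" "(s, z) \<in> R" "(t, w) \<in> R" using two by blast
      then show "(s * t, z * w) \<in> \<Union>\<C>" using sub unfolding \<R>_def by blast
    next
      fix s assume "\<psi> s \<noteq> 0"
      moreover obtain R where "R \<in> \<C>" "R \<in> \<R>"
        using \<open>\<C> \<noteq> {}\<close> sub by blast
      ultimately have "(s, sgn (\<psi> s)) \<in> R"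
        by (simp add: \<R>_def)
      then show "(s, sgn (\<psi> s)) \<in> \<Union>\<C>"
        using \<open>R \<in> \<C>\<close> by blast
    qed
  qed
  ultimately have "\<exists>R\<in>\<R>. \<forall>R'\<in>\<R>. R \<subseteq> R' \<longrightarrow> R' = R"
    by (rule subset_Zorn_nonempty)
  then obtain R where R: "R \<in> \<R>" and max: "\<And>R'. R' \<in> \<R> \<Longrightarrow> R \<subseteq> R' \<Longrightarrow> R' = R"
    by blast
  have unit: "cmod z = 1" if "(s, z) \<in> R" for s z
    using R that by (simp add: \<R>_def)
  have fun_R: "z = w" if "(s, z) \<in> R" "(s, w) \<in> R" for s z w
    using R that unfolding \<R>_def mem_Collect_eq by metis
  have mult_R: "(s * t, z * w) \<in> R" if "(s, z) \<in> R" "(t, w) \<in> R" for s t z w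
    using R that by (simp add: \<R>_def)
  have ext_R: "(s, sgn (\<psi> s)) \<in> R" if "\<psi> s \<noteq> 0" for s
    using R that by (simp add: \<R>_def)
  have one_R: "(1, 1) \<in> R"
    using ext_R[of 1] semicharacter_1[OF \<psi>] by simp
  have power_R: "(s ^ n, z ^ n) \<in> R" if "(s, z) \<in> R" for s z n
    by (induction n) (auto intro: one_R mult_R that)

  have saturated: "(s, z) \<in> R" if "(t, w) \<in> R" "(t * s, w * z) \<in> R" for s t z w
  proof -
    \<comment> \<open>The extension of \<open>R\<close> to quotients. Two values at \<open>s\<close>
      are compared after multiplying by both denominators \<open>t\<close> and \<open>t'\<close>,
      and the values there are cancelled in the circle.\<close>
    define R' where "R' = {(s, z). \<exists>t w. (t, w) \<in> R \<and> (t * s, w * z) \<in> R}"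
    have "R \<subseteq> R'"
      unfolding R'_def using one_R by force
    moreover have "R' \<in> \<R>"
      unfolding \<R>_def mem_Collect_eq
    proof (intro conjI allI impI)
      fix s z assume "(s, z) \<in> R'"
      then obtain t w where "(t, w) \<in> R" "(t * s, w * z) \<in> R"
        unfolding R'_def by blast
      then show "cmod z = 1"
        using unit[of t w] unit[of "t * s" "w * z"] by (simp add: norm_mult)
    next
      fix s z z' assume "(s, z) \<in> R'" "(s, z') \<in> R'"
      then obtain t w t' w' where *: "(t, w) \<in> R" "(t * s, w * z) \<in> R"
        "(t', w') \<in> R" "(t' * s, w' * z') \<in> R"
        unfolding R'_def by blast
      have "(t * t' * s, w * w' * z) \<in> R"
        using mult_R[OF *(3) *(2)] by (simp add: mult_ac)
      moreover have "(t * t' * s, w * w' * z') \<in> R"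
        using mult_R[OF *(1) *(4)] by (simp add: mult_ac)
      ultimately have "w * w' * z = w * w' * z'"
        by (rule fun_R)
      then show "z = z'"
        using unit[OF *(1)] unit[OF *(3)] by auto
    next
      fix s z s' z' assume "(s, z) \<in> R'" "(s', z') \<in> R'"
      then obtain t w t' w' where *: "(t, w) \<in> R" "(t * s, w * z) \<in> R"
        "(t', w') \<in> R" "(t' * s', w' * z') \<in> R"
        unfolding R'_def by blast
      have "(t * t' * (s * s'), w * w' * (z * z')) \<in> R"
        using mult_R[OF *(2) *(4)] by (simp add: mult_ac)
      then show "(s * s', z * z') \<in> R'"
        unfolding R'_def using mult_R[OF *(1) *(3)] by blast
    next
      fix s assume "\<psi> s \<noteq> 0"
      then show "(s, sgn (\<psi> s)) \<in> R'"
        using ext_R \<open>R \<subseteq> R'\<close> by blast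
    qed
    ultimately have "R' = R" by (intro max)
    then show ?thesis
      using that unfolding R'_def by blast
  qed

  have total: "\<exists>z. (a, z) \<in> R" for a
  proof -
    \<comment> \<open>A value \<open>c\<close> at \<open>a\<close> must agree with \<open>R\<close>
      at every power of \<open>a\<close> in the domain. If no positive power lies there, 1 serves;
      otherwise \<open>c\<close> is a root of the value at the least such power.\<close>
    have "\<exists>c. cmod c = 1 \<and> (\<forall>k z. (a ^ k, z) \<in> R \<longrightarrow> z = c ^ k)"
    proof (cases "\<exists>k>0. \<exists>z. (a ^ k, z) \<in> R")
      case False
      then have "k = 0" if "(a ^ k, z) \<in> R" for k z
        using that by (metis gr0I)
      moreover have "z = 1" if "(a ^ 0, z) \<in> R" for z
        using fun_R[of 1 z 1] one_R that by simp
      ultimately have "z = 1 ^ k" if "(a ^ k, z) \<in> R" for k z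
        using that by (metis power_one)
      then show ?thesis
        by (intro exI[of _ 1]) simp
    next
      case True
      define d where "d = (LEAST k. k > 0 \<and> (\<exists>z. (a ^ k, z) \<in> R))"
      have d: "d > 0 \<and> (\<exists>z. (a ^ d, z) \<in> R)"
        unfolding d_def by (rule LeastI_ex) (rule True)
      have d_least: "d \<le> k" if "k > 0" "(a ^ k, z) \<in> R" for k z
        unfolding d_def by (rule Least_le) (use that in auto)
      obtain v where v: "(a ^ d, v) \<in> R"
        using d by blast
      define c where "c = cis (Arg v / d)"
      have "cis (Arg v) = v"
        using unit[OF v] by (metis cis_Arg norm_zero sgn_div_norm div_by_1 scaleR_one inverse_1 zero_neq_one)
      then have c: "c ^ d = v"
        unfolding c_def using d by (simp add: Complex.DeMoivre)
      have "z = c ^ k" if z: "(a ^ k, z) \<in> R" for k z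
      proof -
        \<comment> \<open>Division with remainder: closure under division puts \<open>a ^ r\<close>
          in the domain, and minimality of \<open>d\<close> forces \<open>r = 0\<close>.\<close>
        define q r where "q = k div d" and "r = k mod d"
        have k: "k = d * q + r"
          by (simp add: q_def r_def)
        have "((a ^ d) ^ q, v ^ q) \<in> R"
          by (rule power_R[OF v])
        moreover have "((a ^ d) ^ q * a ^ r, v ^ q * (z / v ^ q)) \<in> R"
          using z unit[OF v] by (auto simp: k power_add power_mult)
        ultimately have "(a ^ r, z / v ^ q) \<in> R"
          by (rule saturated)
        then have "r = 0"
          using d_least[of r "z / v ^ q"] d mod_less_divisor[of d k] by (fold r_def) linarith
        then have "(a ^ k, v ^ q) \<in> R"
          using power_R[OF v, of q] by (simp add: k power_mult)
        then have "z = v ^ q"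
          using fun_R z by blast
        then show ?thesis
          using \<open>r = 0\<close> by (simp add: k power_mult c)
      qed
      then show ?thesis
        by (intro exI[of _ c]) (auto simp: c_def)
    qed
    then obtain c where c: "cmod c = 1" "\<And>k z. (a ^ k, z) \<in> R \<Longrightarrow> z = c ^ k" by blast
    \<comment> \<open>The extension to the semigroup generated by the domain and
      \<open>a\<close>.\<close>
    define R' where "R' = {(t * a ^ n, w * c ^ n) | t w n. (t, w) \<in> R}"
    have R'I: "(t * a ^ n, w * c ^ n) \<in> R'" if "(t, w) \<in> R" for t w n
      unfolding R'_def using that by blast
    have "R \<subseteq> R'"
      using R'I[of _ _ 0] by auto
    \<comment> \<open>Well-definedness: cancelling \<open>a ^ n\<close> in \<open>S\<close> and
      dividing in \<open>R\<close> put \<open>a ^ (m - n)\<close> into the domain, where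
      \<open>c\<close> has the prescribed powers.\<close>
    have wd: "w * c ^ n = w' * c ^ m"
      if "n \<le> m" and R: "(t, w) \<in> R" "(t', w') \<in> R" and eq: "t * a ^ n = t' * a ^ m"
      for t w t' w' n m
    proof -
      have "a ^ n * t = a ^ n * (t' * a ^ (m - n))"
        using eq \<open>n \<le> m\<close> by (metis le_add_diff_inverse mult.assoc mult.commute power_add)
      then have "t = t' * a ^ (m - n)"
        by (rule cancel)
      moreover have "w = w' * (w / w')"
        using unit[OF R(2)] by auto
      ultimately have "(a ^ (m - n), w / w') \<in> R"
        using saturated[OF R(2)] R(1) by metis
      then have "w / w' = c ^ (m - n)"
        by (rule c(2))
      then have "w = w' * c ^ (m - n)"
        using \<open>w = w' * (w / w')\<close> by simp
      then show ?thesis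
        using \<open>n \<le> m\<close> by (simp flip: power_add)
    qed
    have "R' \<in> \<R>"
      unfolding \<R>_def mem_Collect_eq
    proof (intro conjI allI impI)
      fix s z assume "(s, z) \<in> R'"
      then show "cmod z = 1"
        unfolding R'_def using unit c(1) by (auto simp: norm_mult norm_power)
    next
      fix s z z' assume "(s, z) \<in> R'" "(s, z') \<in> R'"
      then obtain t w n t' w' m where "s = t * a ^ n" "z = w * c ^ n" "(t, w) \<in> R"
        "s = t' * a ^ m" "z' = w' * c ^ m" "(t', w') \<in> R"
        unfolding R'_def by blast
      then show "z = z'"
        using wd[of n m t w t' w'] wd[of m n t' w' t w] by (cases "n \<le> m") auto
    next
      fix s z s' z' assume "(s, z) \<in> R'" "(s', z') \<in> R'"
      then obtain t w n t' w' m where *: "s = t * a ^ n" "z = w * c ^ n" "(t, w) \<in> R"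
        "s' = t' * a ^ m" "z' = w' * c ^ m" "(t', w') \<in> R"
        unfolding R'_def by blast
      show "(s * s', z * z') \<in> R'"
        using R'I[OF mult_R[OF *(3) *(6)], of "n + m"] * by (simp add: power_add mult_ac)
    next
      fix s assume "\<psi> s \<noteq> 0"
      then show "(s, sgn (\<psi> s)) \<in> R'"
        using ext_R \<open>R \<subseteq> R'\<close> by blast
    qed
    then have "R' = R"
      using \<open>R \<subseteq> R'\<close> by (rule max)
    then show ?thesis
      using R'I[OF one_R, of 1] by auto
  qed

  obtain \<xi> where \<xi>: "\<And>s. (s, \<xi> s) \<in> R"
    using total by metis
  have "\<xi> (s * t) = \<xi> s * \<xi> t" for s t
    using fun_R[OF \<xi> mult_R[OF \<xi> \<xi>]] .
  moreover have "cmod (\<xi> s) = 1" for s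
    using unit[OF \<xi>] .
  moreover have "\<xi> 1 = 1"
    using fun_R[OF \<xi> one_R] .
  ultimately have "\<xi> \<in> characters"
    by (simp add: characters_def semicharactersI)
  moreover have "\<xi> s = sgn (\<psi> s)" if "\<psi> s \<noteq> 0" for s
    using fun_R[OF \<xi> ext_R[OF that]] .
  ultimately show ?thesis by blast
qed

lemma semicharacter_polar:
  fixes \<psi> :: "'s::comm_monoid_mult \<Rightarrow> complex"
  assumes "\<And>a b c :: 's. a * b = a * c \<Longrightarrow> b = c" and "\<psi> \<in> semicharacters"
  obtains \<xi> where "\<xi> \<in> characters" "\<psi> = modulus \<psi> * \<xi>"
proof -
  obtain \<xi> where \<xi>: "\<xi> \<in> characters" "\<And>s. \<psi> s \<noteq> 0 \<Longrightarrow> \<xi> s = sgn (\<psi> s)"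
    using sgn_semicharacter_extends[of \<psi>] assms by blast
  have "\<psi> s = complex_of_real (cmod (\<psi> s)) * \<xi> s" for s
    using \<xi>(2)[of s] by (cases "\<psi> s = 0") (auto simp: sgn_eq)
  then show ?thesis
    using that[OF \<xi>(1)] by (auto simp: modulus_def fun_eq_iff)
qed

text \<open>By the polar decomposition an orbit is a fibre of \<open>modulus\<close>, so unions of
  orbits become preimages under a continuous map.\<close>

lemma mem_translate_modulus_iff:
  fixes \<psi> :: "'s::comm_monoid_mult \<Rightarrow> complex"
  assumes cancel: "\<And>a b c :: 's. a * b = a * c \<Longrightarrow> b = c"
    and \<rho>: "\<rho> \<in> idempotents"
  shows "\<psi> \<in> translate \<rho> \<longleftrightarrow> \<psi> \<in> semicharacters \<and> modulus \<psi> = \<rho>"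
proof
  assume "\<psi> \<in> translate \<rho>"
  then obtain \<xi> where \<xi>: "\<xi> \<in> characters" "\<psi> = \<rho> * \<xi>"
    by (auto simp: translate_def)
  then have "\<psi> \<in> semicharacters"
    using \<rho> characters_subset times_semicharacters by (auto simp: idempotents_def)
  then show "\<psi> \<in> semicharacters \<and> modulus \<psi> = \<rho>"
    using \<xi> \<rho> by (simp add: modulus_times_character modulus_idempotent)
next
  assume \<psi>: "\<psi> \<in> semicharacters \<and> modulus \<psi> = \<rho>"
  then obtain \<xi> where "\<xi> \<in> characters" "\<psi> = modulus \<psi> * \<xi>"
    using semicharacter_polar[of \<psi>] cancel by blast
  then show "\<psi> \<in> translate \<rho>"
    using \<psi> unfolding translate_def by blast
qed

section \<open>Topology of the space of semicharacters\<close>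

lemma continuous_on_eval [continuous_intros]: "continuous_on S (\<lambda>\<psi>. \<psi> s)"
  for S :: "('s \<Rightarrow> complex) set"
  by (rule continuous_on_subset[OF continuous_on_product_coordinates]) simp

lemma closed_semicharacters: "closed (semicharacters :: ('s::comm_monoid_mult \<Rightarrow> complex) set)"
proof -
  \<comment> \<open>Being nonzero somewhere is not a closed condition; for bounded multiplicative
    functions it amounts to the closed condition \<open>\<psi> 1 = 1\<close>.\<close>
  have "(semicharacters :: ('s \<Rightarrow> complex) set) =
      (\<Inter>s. \<Inter>t. {\<psi>. \<psi> (s * t) = \<psi> s * \<psi> t}) \<inter> (\<Inter>s. {\<psi>. cmod (\<psi> s) \<le> 1}) \<inter> {\<psi>. \<psi> 1 = 1}"
    by (auto simp: semicharacter_mult semicharacter_le_1 semicharacter_1 intro: semicharactersI)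
  also have "closed \<dots>"
    by (intro closed_Int closed_INT ballI closed_Collect_eq closed_Collect_le continuous_intros)
  finally show ?thesis .
qed

text \<open>Tychonoff's theorem: a closed subset of a product of closed discs.\<close>

lemma compact_semicharacters: "compact (semicharacters :: ('s::comm_monoid_mult \<Rightarrow> complex) set)"
proof -
  have "compact (\<Pi>\<^sub>E s\<in>(UNIV :: 's set). cball (0::complex) 1)"
    using compactin_PiE[of "\<lambda>_. euclidean" "UNIV :: 's set" "\<lambda>_. cball (0::complex) 1"]
    by (simp add: euclidean_product_topology)
  then have "compact ((\<Pi>\<^sub>E s\<in>(UNIV :: 's set). cball (0::complex) 1) \<inter> semicharacters)"
    using closed_semicharacters by (rule compact_Int_closed)
  moreover have "semicharacters \<subseteq> (\<Pi>\<^sub>E s\<in>(UNIV :: 's set). cball (0::complex) 1)"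
    by (auto simp: semicharacter_le_1)
  ultimately show ?thesis
    by (simp add: Int_absorb1)
qed

lemma closed_idempotents: "closed (idempotents :: ('s::comm_monoid_mult \<Rightarrow> complex) set)"
proof -
  have "(idempotents :: ('s \<Rightarrow> complex) set) =
      semicharacters \<inter> (\<Inter>s. {\<psi>. \<psi> s * \<psi> s = \<psi> s})"
    by (auto simp: idempotents_def fun_eq_iff)
  also have "closed \<dots>"
    by (intro closed_Int closed_INT ballI closed_semicharacters closed_Collect_eq continuous_intros)
  finally show ?thesis .
qed

lemma continuous_on_modulus [continuous_intros]: "continuous_on S modulus"
  unfolding modulus_def by (intro continuous_on_coordinatewise_then_product continuous_intros)

lemma semichar_power_semicharacters:
  assumes \<rho>: "\<rho> \<in> semicharacters" "\<And>s. \<rho> s \<in> \<real>\<^sub>\<ge>\<^sub>0" and "Re z > 0 \<or> z = 0"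
  shows "semichar_power \<rho> z \<in> semicharacters"
proof (rule semicharactersI)
  have nonneg: "\<rho> s \<in> \<real>" "0 \<le> Re (\<rho> s)" for s
    using \<rho>(2)[of s] nonneg_Reals_subset_Reals by (auto simp: complex_nonneg_Reals_iff)
  show "semichar_power \<rho> z (s * t) = semichar_power \<rho> z s * semichar_power \<rho> z t" for s t
    using nonneg[of s] nonneg[of t]
    by (simp add: semichar_power_def semicharacter_mult[OF \<rho>(1)] powr_times_real)
  show "cmod (semichar_power \<rho> z s) \<le> 1" for s
  proof -
    have "Re (\<rho> s) \<le> 1"
      using semicharacter_le_1[OF \<rho>(1), of s] complex_Re_le_cmod[of "\<rho> s"] by linarith
    then have "Re (\<rho> s) powr Re z \<le> 1"
      using nonneg[of s] assms(3) by (intro powr_le1) auto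
    then show ?thesis
      using nonneg[of s] by (simp add: semichar_power_def norm_powr_real_powr)
  qed
  show "semichar_power \<rho> z 1 = 1"
    by (simp add: semichar_power_def semicharacter_1[OF \<rho>(1)])
qed

section \<open>The algebra of generalized analytic functions\<close>

text \<open>Each coordinate is identically 0 or a constant multiple of an exponential in
  \<open>z\<close>. Because \<open>0 powr 0 = 0\<close>, this includes the point
  \<open>z = 0\<close>.\<close>

lemma continuous_on_semichar_power_times:
  "continuous_on S (\<lambda>z. semichar_power \<rho> z * \<psi>)"
proof (rule continuous_on_coordinatewise_then_product)
  show "continuous_on S (\<lambda>z. (semichar_power \<rho> z * \<psi>) s)" for s
    by (cases "\<rho> s = 0") (auto simp: semichar_power_def powr_def intro!: continuous_intros)
qed

lemma semichar_power_times_semicharacters: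
  assumes "\<rho> \<in> semicharacters" "\<forall>s. \<rho> s \<in> \<real>\<^sub>\<ge>\<^sub>0" "\<psi> \<in> semicharacters" "Re z > 0 \<or> z = 0"
  shows "semichar_power \<rho> z * \<psi> \<in> semicharacters"
  using assms by (intro times_semicharacters semichar_power_semicharacters) auto

text \<open>Continuity at \<open>+0\<close> is automatic for functions that are continuous on all of \<open>semicharacters\<close>.\<close>

lemma semichar_algebra_iff:
  "F \<in> semichar_algebra \<longleftrightarrow> continuous_on semicharacters F \<and>
    (\<forall>\<rho> \<in> semicharacters - characters. \<forall>\<psi> \<in> semicharacters - characters. (\<forall>s. \<rho> s \<in> \<real>\<^sub>\<ge>\<^sub>0) \<longrightarrow>
      (\<lambda>z. F (semichar_power \<rho> z * \<psi>)) holomorphic_on {z. Re z > 0})"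
proof -
  have "continuous (at 0 within {z. Re z > 0}) (\<lambda>z. F (semichar_power \<rho> z * \<psi>))"
    if F: "continuous_on semicharacters F"
      and \<rho>: "\<rho> \<in> semicharacters" "\<forall>s. \<rho> s \<in> \<real>\<^sub>\<ge>\<^sub>0" and \<psi>: "\<psi> \<in> semicharacters" for \<rho> \<psi>
  proof -
    have "continuous_on (insert 0 {z. Re z > 0}) (\<lambda>z. F (semichar_power \<rho> z * \<psi>))"
      by (rule continuous_on_compose2[OF F continuous_on_semichar_power_times])
        (use \<rho> \<psi> in \<open>auto intro: semichar_power_times_semicharacters\<close>)
    then have "continuous (at 0 within insert 0 {z. Re z > 0}) (\<lambda>z. F (semichar_power \<rho> z * \<psi>))"
      by (simp add: continuous_on_eq_continuous_within)
    then show ?thesis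
      by (rule continuous_within_subset) auto
  qed
  then show ?thesis
    by (auto simp: semichar_algebra_def generalized_analytic_def analytic_on_open open_halfspace_Re_gt)
qed

text \<open>Along each curve an evaluation is 0 or an exponential, hence entire. These functions
  separate the points of the space.\<close>

lemma eval_semichar_algebra: "(\<lambda>\<psi>. \<psi> s) \<in> semichar_algebra"
proof -
  have "(\<lambda>z. (semichar_power \<rho> z * \<psi>) s) holomorphic_on S" for \<rho> \<psi> S
    by (cases "\<rho> s = 0") (auto simp: semichar_power_def powr_def intro!: holomorphic_intros)
  then show ?thesis
    unfolding semichar_algebra_iff by (auto intro: continuous_intros)
qed

lemma uniform_algebra_semichar_algebra:
  "uniform_algebra (semicharacters :: ('s::comm_monoid_mult \<Rightarrow> complex) set) semichar_algebra"
proof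
  show "compact (semicharacters :: ('s \<Rightarrow> complex) set)" "closed (semicharacters :: ('s \<Rightarrow> complex) set)"
    by (rule compact_semicharacters closed_semicharacters)+
  show "semicharacters \<noteq> ({} :: ('s \<Rightarrow> complex) set)"
    using one_characters characters_subset by blast
  fix f g :: "('s \<Rightarrow> complex) \<Rightarrow> complex"
  show "(\<lambda>_::'s \<Rightarrow> complex. c) \<in> semichar_algebra" for c
    by (simp add: semichar_algebra_iff)
  assume f: "f \<in> semichar_algebra"
  then show "continuous_on semicharacters f"
    by (simp add: semichar_algebra_iff)
  assume g: "g \<in> semichar_algebra"
  show "(\<lambda>y. f y + g y) \<in> semichar_algebra" "(\<lambda>y. f y * g y) \<in> semichar_algebra"
    using f g by (auto simp: semichar_algebra_iff intro!: continuous_intros holomorphic_intros)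
next
  fix h :: "nat \<Rightarrow> ('s \<Rightarrow> complex) \<Rightarrow> complex" and g
  assume h: "\<And>n. h n \<in> semichar_algebra" and lim: "uniform_limit semicharacters h g sequentially"
  show "g \<in> semichar_algebra"
    unfolding semichar_algebra_iff
  proof (intro conjI ballI impI)
    show "continuous_on semicharacters g"
      using lim by (rule uniform_limit_theorem[rotated]) (use h in \<open>auto simp: semichar_algebra_iff\<close>)
    fix \<rho> \<psi> :: "'s \<Rightarrow> complex"
    assume \<rho>: "\<rho> \<in> semicharacters - characters" "\<forall>s. \<rho> s \<in> \<real>\<^sub>\<ge>\<^sub>0"
      and \<psi>: "\<psi> \<in> semicharacters - characters"
    \<comment> \<open>The curve stays in the space of semicharacters, so uniform convergence pulls
      back to the half-plane, where uniform limits of holomorphic functions are holomorphic.\<close>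
    have lim': "uniform_limit {z. Re z > 0} (\<lambda>n z. h n (semichar_power \<rho> z * \<psi>))
        (\<lambda>z. g (semichar_power \<rho> z * \<psi>)) sequentially"
      by (rule uniform_limit_compose'[OF lim])
        (use \<rho> \<psi> in \<open>auto intro: semichar_power_times_semicharacters\<close>)
    show "(\<lambda>z. g (semichar_power \<rho> z * \<psi>)) holomorphic_on {z. Re z > 0}"
    proof (rule holomorphic_uniform_sequence)
      show "open {z. Re z > 0}"
        by (rule open_halfspace_Re_gt)
      show "(\<lambda>z. h n (semichar_power \<rho> z * \<psi>)) holomorphic_on {z. Re z > 0}" for n
        using h[of n] \<rho> \<psi> by (auto simp: semichar_algebra_iff)
      fix z assume "z \<in> {z. Re z > 0}"
      then obtain d where "0 < d" "cball z d \<subseteq> {z. Re z > 0}"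
        using open_contains_cball open_halfspace_Re_gt[of 0] by blast
      then show "\<exists>d>0. cball z d \<subseteq> {z. Re z > 0} \<and> uniform_limit (cball z d)
          (\<lambda>n z. h n (semichar_power \<rho> z * \<psi>)) (\<lambda>z. g (semichar_power \<rho> z * \<psi>)) sequentially"
        using uniform_limit_on_subset[OF lim'] by blast
    qed
  qed
next
  fix x y :: "'s \<Rightarrow> complex" assume "x \<noteq> y"
  then obtain s where "x s \<noteq> y s"
    by (auto simp: fun_eq_iff)
  then show "\<exists>f\<in>semichar_algebra. f x \<noteq> f y"
    by (intro bexI[OF _ eval_semichar_algebra[of s]])
qed

text \<open>The curve through \<psi>, multiplied by \<xi>, is the curve through
  \<open>\<psi> * \<xi>\<close>, and this base point is again not a character.\<close>

lemma semichar_algebra_translate: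
  fixes \<xi> :: "'s::comm_monoid_mult \<Rightarrow> complex"
  assumes F: "F \<in> semichar_algebra" and \<xi>: "\<xi> \<in> characters"
  shows "(\<lambda>\<psi>. F (\<psi> * \<xi>)) \<in> semichar_algebra"
  unfolding semichar_algebra_iff
proof (intro conjI ballI impI)
  have "continuous_on semicharacters (\<lambda>\<psi>. \<psi> * \<xi>)"
    by (intro continuous_on_coordinatewise_then_product) (auto intro!: continuous_intros)
  moreover have "continuous_on semicharacters F"
    using F by (simp add: semichar_algebra_iff)
  ultimately show "continuous_on semicharacters (\<lambda>\<psi>. F (\<psi> * \<xi>))"
    by (intro continuous_on_compose2[where f = "\<lambda>\<psi>. \<psi> * \<xi>" and g = F])
      (use \<xi> characters_subset in \<open>auto intro: times_semicharacters\<close>)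
  fix \<rho> \<psi> :: "'s \<Rightarrow> complex"
  assume \<rho>: "\<rho> \<in> semicharacters - characters" "\<forall>s. \<rho> s \<in> \<real>\<^sub>\<ge>\<^sub>0"
    and \<psi>: "\<psi> \<in> semicharacters - characters"
  have "\<psi> * \<xi> \<in> semicharacters - characters"
    using \<psi> \<xi> times_semicharacters[of \<psi> \<xi>] by (auto simp: characters_def norm_mult)
  then show "(\<lambda>z. F (semichar_power \<rho> z * \<psi> * \<xi>)) holomorphic_on {z. Re z > 0}"
    using F \<rho> unfolding semichar_algebra_iff by (auto simp: mult.assoc)
qed

section \<open>p-points of the algebra of generalized analytic functions\<close>

text \<open>Precomposition with multiplication by the inverse character preserves the algebra and
  the sup norm, and moves functions that isolate \<psi> to functions that isolate
  \<open>\<psi> * \<xi>\<close>.\<close>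

lemma strong_boundary_times_character:
  fixes \<psi> :: "'s::comm_monoid_mult \<Rightarrow> complex"
  assumes \<psi>: "\<psi> \<in> strong_boundary semicharacters semichar_algebra" and \<xi>: "\<xi> \<in> characters"
  shows "\<psi> * \<xi> \<in> strong_boundary semicharacters semichar_algebra"
proof -
  interpret uniform_algebra "semicharacters :: ('s \<Rightarrow> complex) set" semichar_algebra
    by (rule uniform_algebra_semichar_algebra)
  define \<eta> where "\<eta> = (\<lambda>s. inverse (\<xi> s))"
  have \<eta>: "\<eta> \<in> characters"
    unfolding \<eta>_def using \<xi> by (rule inverse_characters)
  have "\<xi> s \<noteq> 0" for s
    using \<xi> by (auto simp: characters_def dest!: spec[of _ s])
  then have cancel: "\<phi> * \<xi> * \<eta> = \<phi>" "\<phi> * \<eta> * \<xi> = \<phi>" for \<phi>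
    by (auto simp: \<eta>_def fun_eq_iff)
  have mem: "\<phi> * \<xi> \<in> semicharacters" "\<phi> * \<eta> \<in> semicharacters" if "\<phi> \<in> semicharacters" for \<phi>
    using that \<xi> \<eta> characters_subset times_semicharacters by blast+
  show ?thesis
    unfolding strong_boundary_iff
  proof (intro conjI ballI impI)
    show "\<psi> * \<xi> \<in> semicharacters"
      using \<psi> mem unfolding strong_boundary_iff by blast
    fix \<phi> assume \<phi>: "\<phi> \<in> semicharacters" "\<phi> \<noteq> \<psi> * \<xi>"
    then have "\<phi> * \<eta> \<in> semicharacters" "\<phi> * \<eta> \<noteq> \<psi>"
      using mem cancel by auto
    then obtain f where f: "f \<in> semichar_algebra" "\<forall>w\<in>semicharacters. cmod (f w) \<le> 1"
      "f \<psi> = 1" "f (\<phi> * \<eta>) \<noteq> 1"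
      using \<psi> unfolding strong_boundary_iff by blast
    then show "\<exists>f\<in>semichar_algebra. (\<forall>w\<in>semicharacters. cmod (f w) \<le> 1) \<and> f (\<psi> * \<xi>) = 1 \<and> f \<phi> \<noteq> 1"
      using mem cancel by (intro bexI[OF _ semichar_algebra_translate[OF f(1) \<eta>]]) auto
  qed
qed

lemma one_strong_boundary:
  "(1 :: 's::comm_monoid_mult \<Rightarrow> complex) \<in> strong_boundary semicharacters semichar_algebra"
proof -
  interpret uniform_algebra "semicharacters :: ('s \<Rightarrow> complex) set" semichar_algebra
    by (rule uniform_algebra_semichar_algebra)
  show ?thesis
    unfolding strong_boundary_iff
  proof (intro conjI ballI impI)
    show "(1 :: 's \<Rightarrow> complex) \<in> semicharacters"
      using one_characters characters_subset by blast
    fix \<phi> :: "'s \<Rightarrow> complex" assume "\<phi> \<noteq> 1"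
    then obtain s where "\<phi> s \<noteq> 1"
      by (auto simp: fun_eq_iff)
    then show "\<exists>f\<in>semichar_algebra. (\<forall>w\<in>semicharacters. cmod (f w) \<le> 1) \<and> f 1 = 1 \<and> f \<phi> \<noteq> 1"
      by (intro bexI[OF _ eval_semichar_algebra[of s]]) (auto simp: semicharacter_le_1)
  qed
qed

lemma modulus_strong_boundary:
  fixes \<psi> :: "'s::comm_monoid_mult \<Rightarrow> complex"
  assumes cancel: "\<And>a b c :: 's. a * b = a * c \<Longrightarrow> b = c"
    and \<psi>: "\<psi> \<in> strong_boundary semicharacters semichar_algebra"
  shows "modulus \<psi> \<in> idempotents"
proof -
  interpret uniform_algebra "semicharacters :: ('s \<Rightarrow> complex) set" semichar_algebra
    by (rule uniform_algebra_semichar_algebra)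
  define \<rho> where "\<rho> = modulus \<psi>"
  have \<psi>_mem: "\<psi> \<in> semicharacters"
    using \<psi> by (simp add: strong_boundary_iff)
  then have \<rho>_mem: "\<rho> \<in> semicharacters"
    unfolding \<rho>_def by (rule modulus_semicharacters)
  have \<rho>_nonneg: "\<forall>s. \<rho> s \<in> \<real>\<^sub>\<ge>\<^sub>0"
    by (simp add: \<rho>_def modulus_def)
  have "cmod (\<psi> s) * cmod (\<psi> s) = cmod (\<psi> s)" for s
  proof (cases "\<rho> \<in> characters")
    case True
    then show ?thesis
      by (simp add: characters_def \<rho>_def modulus_def)
  next
    case False
    obtain \<xi> where \<xi>: "\<xi> \<in> characters" "\<psi> = \<rho> * \<xi>"
      unfolding \<rho>_def using semicharacter_polar[of \<psi>] cancel \<psi>_mem by blast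
    \<comment> \<open>The base point of a curve must lie outside the characters, which excludes
      \<xi> itself. Half of the modulus goes into \<phi>, so that \<psi> is reached at the interior
      point \<open>z = 1/2\<close>.\<close>
    define \<phi> where "\<phi> = semichar_power \<rho> (1/2) * \<xi>"
    have norm_\<xi>: "cmod (\<xi> t) = 1" for t
      using \<xi>(1) by (simp add: characters_def)
    have norm_\<phi>: "cmod (\<phi> t) = cmod (\<psi> t) powr (1/2)" for t
      by (simp add: \<phi>_def semichar_power_def \<rho>_def modulus_def norm_mult norm_\<xi> norm_powr_real_powr)
    have norm_pow: "cmod ((semichar_power \<rho> z * \<phi>) t) = cmod (\<psi> t) powr (Re z + 1/2)" for z t
      by (simp add: norm_\<phi> semichar_power_def \<rho>_def modulus_def norm_mult
          norm_powr_real_powr powr_add)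
    have half: "semichar_power \<rho> (1/2) * \<phi> = \<psi>"
    proof
      fix t
      have "\<rho> t powr (1/2) * \<rho> t powr (1/2) = \<rho> t"
        by (cases "\<rho> t = 0") (auto simp flip: powr_add)
      then show "(semichar_power \<rho> (1/2) * \<phi>) t = \<psi> t"
        by (simp add: \<phi>_def semichar_power_def fun_cong[OF \<xi>(2)] flip: mult.assoc)
    qed
    have \<phi>_mem: "\<phi> \<in> semicharacters"
      unfolding \<phi>_def using \<rho>_mem \<rho>_nonneg \<xi>(1) characters_subset
      by (intro semichar_power_times_semicharacters) auto
    have \<phi>: "\<phi> \<in> semicharacters - characters"
    proof -
      have False if "\<phi> \<in> characters"
      proof -
        have "cmod (\<rho> t) = 1" for t
        proof -
          have "cmod (\<psi> t) powr (1/2) = 1"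
            using norm_\<phi>[of t] that by (simp add: characters_def)
          then show ?thesis
            by (auto simp: \<rho>_def modulus_def powr_half_sqrt)
        qed
        then show False
          using False \<rho>_mem by (simp add: characters_def)
      qed
      then show ?thesis
        using \<phi>_mem by blast
    qed
    \<comment> \<open>At \<open>z = 3/2\<close> the total exponent of \<rho> is 2, so this equality
      says that squaring the modulus of \<psi> does not change it.\<close>
    have "semichar_power \<rho> (3/2) * \<phi> = \<psi>"
    proof (rule ccontr)
      assume "semichar_power \<rho> (3/2) * \<phi> \<noteq> \<psi>"
      moreover have mem: "semichar_power \<rho> z * \<phi> \<in> semicharacters" if "Re z > 0" for z
        using that \<rho>_mem \<rho>_nonneg \<phi>_mem by (intro semichar_power_times_semicharacters) auto
      ultimately obtain f where f: "f \<in> semichar_algebra" "\<forall>w\<in>semicharacters. cmod (f w) \<le> 1"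
        "f \<psi> = 1" "f (semichar_power \<rho> (3/2) * \<phi>) \<noteq> 1"
        using \<psi> mem[of "3/2"] unfolding strong_boundary_iff by auto
      \<comment> \<open>The modulus is at most 1 along the curve and equals 1 at the interior point
        \<open>1/2\<close>.\<close>
      have "(\<lambda>z. f (semichar_power \<rho> z * \<phi>)) constant_on {z. Re z > 0}"
      proof (rule maximum_modulus_principle)
        show "(\<lambda>z. f (semichar_power \<rho> z * \<phi>)) holomorphic_on {z. Re z > 0}"
          using f(1) \<rho>_mem False \<rho>_nonneg \<phi> unfolding semichar_algebra_iff by blast
        show "open {z. Re z > 0}" "open {z. Re z > 0}"
          by (rule open_halfspace_Re_gt)+
        show "connected {z. Re z > 0}"
          by (intro convex_connected convex_halfspace_Re_gt)
        show "1/2 \<in> {z. Re z > 0}"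
          by simp
        show "cmod (f (semichar_power \<rho> z * \<phi>)) \<le> cmod (f (semichar_power \<rho> (1/2) * \<phi>))"
          if "z \<in> {z. Re z > 0}" for z
          using f(2) mem[of z] that by (simp add: half f(3))
      qed simp
      then obtain c where c: "\<And>z. Re z > 0 \<Longrightarrow> f (semichar_power \<rho> z * \<phi>) = c"
        by (auto simp: constant_on_def)
      show False
        using c[of "1/2"] c[of "3/2"] half f(3,4) by simp
    qed
    then have "cmod (\<psi> s) powr 2 = cmod (\<psi> s)"
      using norm_pow[of "3/2" s] by simp
    then show ?thesis
      by (cases "\<psi> s = 0") (auto simp: power2_eq_square)
  qed
  then have "\<rho> * \<rho> = \<rho>"
    by (simp add: \<rho>_def modulus_def fun_eq_iff flip: of_real_mult)
  then show ?thesis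
    using \<rho>_mem by (simp add: idempotents_def \<rho>_def)
qed

section \<open>Orbit decomposition of the Shilov boundary\<close>

theorem mainTheorem2:
  fixes \<Gamma> F K :: "('s::comm_monoid_mult \<Rightarrow> complex) set"
  assumes cancel: "\<And>a b c :: 's. a * b = a * c \<Longrightarrow> b = c"
    and \<Gamma>: "\<Gamma> = strong_boundary semicharacters semichar_algebra"
    and F: "F = modulus ` \<Gamma>"
    and K: "K = top_of_set semicharacters closure_of F"
  shows "F \<subseteq> idempotents
    \<and> \<Gamma> = (\<Union>\<rho>\<in>F. translate \<rho>) \<and> disjoint_family_on translate F
    \<and> is_Shilov_boundary semicharacters semichar_algebra (\<Union>\<rho>\<in>K. translate \<rho>)
    \<and> disjoint_family_on translate K
    \<and> compact K \<and> K \<subseteq> idempotents \<and> 1 \<in> K"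
proof -
  interpret uniform_algebra "semicharacters :: ('s \<Rightarrow> complex) set" semichar_algebra
    by (rule uniform_algebra_semichar_algebra)
  \<comment> \<open>The space of semicharacters is closed in the full product, so relative and
    absolute closures agree.\<close>
  have closure_of_eq: "top_of_set semicharacters closure_of T = closure T"
    if "T \<subseteq> semicharacters" for T :: "('s \<Rightarrow> complex) set"
    using that closure_minimal[OF that closed_semicharacters]
    by (simp add: closure_of_subtopology Int_absorb1 Int_absorb2)
  have F_sub: "F \<subseteq> idempotents"
    using modulus_strong_boundary[of _] cancel unfolding F \<Gamma> by blast
  have idem_sub: "idempotents \<subseteq> (semicharacters :: ('s \<Rightarrow> complex) set)"
    by (auto simp: idempotents_def)
  have K_eq: "K = closure F"
    unfolding K using F_sub idem_sub by (intro closure_of_eq) auto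
  have K_sub: "K \<subseteq> idempotents"
    unfolding K_eq using F_sub closed_idempotents by (rule closure_minimal)
  have "compact (semicharacters \<inter> K)"
    unfolding K_eq by (intro compact_Int_closed compact_semicharacters closed_closure)
  then have compact_K: "compact K"
    using K_sub idem_sub by (simp add: Int_absorb1)
  have \<Gamma>_sub: "\<Gamma> \<subseteq> semicharacters"
    by (auto simp: \<Gamma> strong_boundary_def)
  have mem_translate: "\<psi> \<in> translate \<rho> \<longleftrightarrow> \<psi> \<in> semicharacters \<and> modulus \<psi> = \<rho>"
    if "\<rho> \<in> idempotents" for \<psi> \<rho> :: "'s \<Rightarrow> complex"
    using mem_translate_modulus_iff[of \<rho> \<psi>] cancel that by blast
  have union_translate: "(\<Union>\<rho>\<in>I. translate \<rho>) = {\<psi> \<in> semicharacters. modulus \<psi> \<in> I}"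
    if "I \<subseteq> idempotents" for I :: "('s \<Rightarrow> complex) set"
  proof -
    have "\<rho> \<in> idempotents" if "\<rho> \<in> I" for \<rho>
      using that \<open>I \<subseteq> idempotents\<close> by blast
    then show ?thesis
      by (auto simp: mem_translate)
  qed
  have \<Gamma>_translate: "\<psi> * \<xi> \<in> \<Gamma>" if "\<psi> \<in> \<Gamma>" "\<xi> \<in> characters" for \<psi> \<xi>
    using that strong_boundary_times_character unfolding \<Gamma> by blast
  \<comment> \<open>Multiplying a p-point by the inverse of its phase character gives its modulus,
    which is therefore a p-point too.\<close>
  have F_\<Gamma>: "F \<subseteq> \<Gamma>"
  proof
    fix \<rho> assume "\<rho> \<in> F"
    then obtain \<psi> where "\<psi> \<in> \<Gamma>" "\<rho> = modulus \<psi>"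
      unfolding F by blast
    moreover obtain \<xi> where \<xi>: "\<xi> \<in> characters" "\<psi> = modulus \<psi> * \<xi>"
      using semicharacter_polar[of \<psi>] cancel \<open>\<psi> \<in> \<Gamma>\<close> \<Gamma>_sub by blast
    moreover have "\<xi> s \<noteq> 0" for s
      using \<xi>(1) by (auto simp: characters_def dest!: spec[of _ s])
    then have "modulus \<psi> * \<xi> * (\<lambda>s. inverse (\<xi> s)) = modulus \<psi>"
      by (auto simp: fun_eq_iff)
    ultimately show "\<rho> \<in> \<Gamma>"
      using \<Gamma>_translate[of \<psi> "\<lambda>s. inverse (\<xi> s)"] inverse_characters[of \<xi>] by metis
  qed
  have \<Gamma>_eq: "\<Gamma> = (\<Union>\<rho>\<in>F. translate \<rho>)"
  proof
    show "\<Gamma> \<subseteq> (\<Union>\<rho>\<in>F. translate \<rho>)"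
      unfolding union_translate[OF F_sub] using \<Gamma>_sub F by blast
    show "(\<Union>\<rho>\<in>F. translate \<rho>) \<subseteq> \<Gamma>"
      using \<Gamma>_translate F_\<Gamma> unfolding translate_def by blast
  qed
  have "closure \<Gamma> = (\<Union>\<rho>\<in>K. translate \<rho>)"
  proof
    \<comment> \<open>One inclusion: the orbits over \<open>K\<close> form the preimage of a closed
      set under the continuous map \<open>modulus\<close>.\<close>
    have "closed (semicharacters \<inter> modulus -` K)"
      unfolding K_eq
      by (intro continuous_closed_preimage continuous_on_modulus closed_semicharacters closed_closure)
    moreover have "\<Gamma> \<subseteq> semicharacters \<inter> modulus -` K"
      using \<Gamma>_sub closure_subset[of F] unfolding K_eq F by auto
    ultimately have "closure \<Gamma> \<subseteq> semicharacters \<inter> modulus -` K"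
      by (intro closure_minimal)
    then show "closure \<Gamma> \<subseteq> (\<Union>\<rho>\<in>K. translate \<rho>)"
      unfolding union_translate[OF K_sub] by blast
    \<comment> \<open>The other inclusion: multiplication by a fixed \<xi> is continuous and sends
      \<open>F\<close> into \<Gamma>, hence \<open>closure F\<close> into
      \<open>closure \<Gamma>\<close>.\<close>
    have "\<rho> * \<xi> \<in> closure \<Gamma>" if "\<rho> \<in> K" "\<xi> \<in> characters" for \<rho> \<xi>
    proof -
      have "continuous_on (closure F) (\<lambda>\<sigma>. \<sigma> * \<xi>)"
        by (intro continuous_on_coordinatewise_then_product) (auto intro!: continuous_intros)
      moreover have "(\<lambda>\<sigma>. \<sigma> * \<xi>) ` F \<subseteq> closure \<Gamma>"
        using \<Gamma>_translate F_\<Gamma> that(2) closure_subset by blast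
      ultimately have "(\<lambda>\<sigma>. \<sigma> * \<xi>) ` closure F \<subseteq> closure \<Gamma>"
        by (intro image_closure_subset) auto
      then show ?thesis
        using that(1) unfolding K_eq by blast
    qed
    then show "(\<Union>\<rho>\<in>K. translate \<rho>) \<subseteq> closure \<Gamma>"
      unfolding translate_def by blast
  qed
  then have "is_Shilov_boundary semicharacters semichar_algebra (\<Union>\<rho>\<in>K. translate \<rho>)"
    using Shilov_boundary_closure_strong_boundary closure_of_eq[OF \<Gamma>_sub] unfolding \<Gamma> by simp
  moreover have "1 \<in> K"
  proof -
    have "modulus 1 = (1 :: 's \<Rightarrow> complex)"
      by (auto simp: modulus_def fun_eq_iff)
    then have "1 \<in> F"
      using one_strong_boundary unfolding F \<Gamma> by force
    then show ?thesis
      unfolding K_eq using closure_subset by blast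
  qed
  ultimately show ?thesis
    using F_sub \<Gamma>_eq K_sub compact_K disjoint_translates by blast
qed

end
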